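(* Let $f(\bm w)=\mathbb{E}_{\xi\sim\mathcal D}f(\bm w;\xi)$ on $\mathbb{R}^d$ satisfy the heavy-tailed noise assumption (constants $\sigma>0$, $p\in(1,2]$) and the individual Lipschitz assumption (constant $L>0$) given in the context, and let $T\ge1$ be an integer. Let $(\bm w^t)_{t\ge0}$ be generated by the NSGDC-VR algorithm (see context) with $$1-\theta=\min\Big\{\frac{1}{\max\{\sigma^{\frac{p}{2p-1}},\sigma^{\frac{2p-2}{2p-1}}\}\,T^{\frac{p}{2p-1}}},1\Big\},\qquad \gamma=\frac{\sqrt[4]{1-\theta}}{L\sqrt T},$$ $$h=2\Big(\gamma L T^{\frac{5p+2}{8p-4}}\cdot\max\{1,\sigma^{\frac{9p}{8p-4}}\}+\|\nabla f(\bm w^0)\|\Big).$$ Then $$\begin{aligned} \frac1T\sum_{t=1}^T\mathbb{E}\|\nabla f(\bm w^t)\|\le{}&\frac{20\sigma^{\frac{p}{2p-1}}+2\|\nabla f(\bm w^0)\|\big(\sigma^{\frac{p}{2p-1}}+\sigma^{\frac{2p-2}{2p-1}}\big)+16\sigma^{\frac{p}{16}}}{T^{\frac{p-1}{2p-1}}}\\ &+\frac{[L(f(\bm w^0)-\min f)+5]\big(\sigma^{\frac{p-1}{4p-2}}+\sigma^{\frac{p}{8p-4}}\big)}{T^{\frac{3p-2}{8p-4}}}+\frac{16\|\nabla f(\bm w^0)\|^{\frac{2-p}{2}}\big(\sigma^{\frac{p^2-p}{2p-1}}+\sigma^{\frac{2p^2-5p+2}{4p-2}}\big)}{T^{\frac{p}{4p-2}}}\\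 &+\frac{16\sigma^{\frac{5p^2-9p+6}{8p-4}}}{T^{\frac{5p-1}{8p-4}}}+\frac{L(f(\bm w^0)-\min f)+16\|\nabla f(\bm w^0)\|^{\frac{2-p}{2}}+9}{T^{\frac12}}+\frac{2\|\nabla f(\bm w^0)\|}{T}. \end{aligned}$$
   Context: Setting: $\mathcal D$ is a probability distribution on a sample space $\Xi$; $f(\bm w)=\mathbb{E}_{\xi\sim\mathcal D}f(\bm w;\xi)$, $\bm w\in\mathbb{R}^d$, with all functions differentiable in $\bm w$. $\|\cdot\|$ is the Euclidean norm; $\min f$ is the minimum value of $f$ (understood as its infimum, assumed finite). Heavy-tailed noise assumption: $\sigma>0$ and $p\in(1,2]$ satisfy $\sup_{\bm w\in\mathbb{R}^d}\mathbb{E}_{\xi\sim\mathcal D}\|\nabla f(\bm w;\xi)-\nabla f(\bm w)\|^p\le\sigma^p$. Individual Lipschitz assumption: there is $L>0$ with $\|\nabla f(\bm y;\xi)-\nabla f(\bm x;\xi)\|\le L\|\bm y-\bm x\|$ for all $\bm x,\bm y\in\mathbb{R}^d$ and all $\xi$; $\mathbb{E}_{\xi\sim\mathcal D}[\nabla f(\bm w;\xi)]=\nabla f(\bm w)$ for all $\bm w$; at the (deterministic) initial point $\bm w^0$, $B:=\sup_{\xi\sim\mathcal D}\|\nabla f(\bm w^0;\xi)\|<+\infty$ almost surely, with $B>0$; and $\inf_{\bm w} f(\bm w;\xi)>-\infty$ for each $\xi$. Clipping: for $h>0$, $\mathrm{Clip}_h(\bm w):=\min\{1,h/\|\bm w\|\}\,\bm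 w$. NSGDC-VR algorithm (parameters $\gamma>0$, $0\le\theta<1$, $h>0$): initialize $\bm w^0=\bm w^1$, $\bm m^0=\bm 0$. For $t=1,2,\dots$: sample $\xi^t\sim\mathcal D$ (independently of the past), put $\bm g^t=\nabla f(\bm w^t;\xi^t)$, set $\bm m^t=\theta\bm m^{t-1}+(1-\theta)\mathrm{Clip}_h(\bm g^t)+\theta\nabla f(\bm w^t;\xi^t)-\theta\nabla f(\bm w^{t-1};\xi^t)$ and $\bm w^{t+1}=\bm w^t-\gamma\,\bm m^t/\|\bm m^t\|$ (with $\bm m/\|\bm m\|$ read as $\bm 0$ if $\bm m=\bm 0$). *)

theory Defs
  imports "HOL-Probability.Probability" "HOL-Probability.Essential_Supremum"
begin

text \<open>Meaningful only where the function is differentiable; the gradient is then unique.\<close>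
definition grad :: "('v::real_inner \<Rightarrow> real) \<Rightarrow> 'v \<Rightarrow> 'v" where
  "grad f w = (THE g. GDERIV f w :> g)"

text \<open>A stochastic objective is a function \<open>F w \<xi>\<close> of the parameter and the sample; gradients
  are always taken with respect to the parameter.\<close>
definition sgrad :: "('v::real_inner \<Rightarrow> 'x \<Rightarrow> real) \<Rightarrow> 'v \<Rightarrow> 'x \<Rightarrow> 'v" where
  "sgrad F w \<xi> = grad (\<lambda>v. F v \<xi>) w"

definition objective :: "'x measure \<Rightarrow> ('v \<Rightarrow> 'x \<Rightarrow> real) \<Rightarrow> 'v \<Rightarrow> real" where
  "objective D F w = (\<integral>\<xi>. F w \<xi> \<partial>D)"

text \<open>The \<open>p\<close>-th moment is a nonnegative integral, so that an infinite moment violates the bound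
  (a Bochner integral would be 0 in that case).\<close>
definition heavy_tailed_noise ::
  "'x measure \<Rightarrow> ('v::real_inner \<Rightarrow> 'x \<Rightarrow> real) \<Rightarrow> real \<Rightarrow> real \<Rightarrow> bool" where
  "heavy_tailed_noise D F \<sigma> p \<longleftrightarrow>
     (SUP w. \<integral>\<^sup>+\<xi>. ennreal (norm (sgrad F w \<xi> - grad (objective D F) w) powr p) \<partial>D)
       \<le> ennreal (\<sigma> powr p)"

text \<open>The almost sure supremum of the stochastic gradient norm at the initial point is the
  essential supremum with respect to \<open>D\<close>.\<close>
definition individual_lipschitz ::
  "'x measure \<Rightarrow> ('v::euclidean_space \<Rightarrow> 'x \<Rightarrow> real) \<Rightarrow> real \<Rightarrow> 'v \<Rightarrow> bool" where
  "individual_lipschitz D F L w0 \<longleftrightarrow>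
     (\<forall>\<xi>\<in>space D. \<forall>x y. norm (sgrad F y \<xi> - sgrad F x \<xi>) \<le> L * norm (y - x)) \<and>
     (\<forall>w. has_bochner_integral D (sgrad F w) (grad (objective D F) w)) \<and>
     0 < esssup D (\<lambda>\<xi>. ereal (norm (sgrad F w0 \<xi>))) \<and>
     esssup D (\<lambda>\<xi>. ereal (norm (sgrad F w0 \<xi>))) < \<infinity> \<and>
     (\<forall>\<xi>\<in>space D. bdd_below (range (\<lambda>w. F w \<xi>)))"

text \<open>At \<open>w = 0\<close> the value is 0, whatever the quotient \<open>h / 0\<close> is.\<close>
definition clip :: "real \<Rightarrow> 'v::real_normed_vector \<Rightarrow> 'v" where
  "clip h w = min 1 (h / norm w) *\<^sub>R w"

text \<open>One run along the sample sequence \<open>\<xi> 1, \<xi> 2, \<dots>\<close> (\<open>\<xi> 0\<close> is not used).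
  The library function \<open>sgn\<close> on vectors is normalization, with \<open>sgn 0 = 0\<close>.\<close>
definition nsgdc_vr ::
  "('v::real_inner \<Rightarrow> 'x \<Rightarrow> real) \<Rightarrow> real \<Rightarrow> real \<Rightarrow> real \<Rightarrow> 'v \<Rightarrow>
    (nat \<Rightarrow> 'x) \<Rightarrow> (nat \<Rightarrow> 'v) \<Rightarrow> (nat \<Rightarrow> 'v) \<Rightarrow> bool" where
  "nsgdc_vr F \<gamma> \<theta> h w0 \<xi> w m \<longleftrightarrow>
     w 0 = w0 \<and> w 1 = w0 \<and> m 0 = 0 \<and>
     (\<forall>t\<ge>1.
        m t = \<theta> *\<^sub>R m (t - 1) + (1 - \<theta>) *\<^sub>R clip h (sgrad F (w t) (\<xi> t))
              + \<theta> *\<^sub>R sgrad F (w t) (\<xi> t) - \<theta> *\<^sub>R sgrad F (w (t - 1)) (\<xi> t) \<and>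
        w (t + 1) = w t - \<gamma> *\<^sub>R sgn (m t))"

text \<open>Real power with the convention \<open>0\<^sup>0 = 1\<close>; the library's \<open>0 powr 0\<close> is 0.\<close>
definition rpow :: "real \<Rightarrow> real \<Rightarrow> real" where
  "rpow x a = (if a = 0 then 1 else x powr a)"

end

theory Submission
  imports Defs
begin

text \<open>
  The error of the momentum \<open>m\<close> satisfies a linear recursion with factor \<open>\<theta>\<close>. Its forcing term is
  the clipping bias, at most \<open>\<sigma>\<^sup>p (h/2)\<^sup>1\<^sup>-\<^sup>p\<close> because \<open>h\<close> is at least twice every gradient norm met
  along the run, plus a term that is centred given the past. The latter accumulates in mean square
  only up to \<open>1 / (1 - \<theta>)\<close> times its conditional second moment, to which the clipped noise
  contributes at most \<open>(1 - \<theta>)\<^sup>2 \<sigma>\<^sup>p (3h/2)\<^sup>2\<^sup>-\<^sup>p\<close> and the gradient differences, by individual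
  Lipschitz continuity, at most \<open>(L\<gamma>)\<^sup>2\<close>, up to a factor 2. Inserting this into the descent inequality
  for normalized steps bounds the average gradient norm. For the given parameters the resulting
  terms are monomials in \<open>\<sigma>\<close> and \<open>T\<close>, and they are compared with the claimed rate according to
  whether \<open>\<sigma> \<ge> 1\<close> and whether \<open>\<theta> > 0\<close>.
\<close>

subsection \<open>Gradients, clipping and joint measurability\<close>

text \<open>The derivative is a linear functional, represented in the inner product by
  \<open>adjoint f' 1\<close>. Uniqueness of derivatives makes this vector unique, which justifies
  the \<open>THE\<close> in \<open>grad\<close>.\<close>

lemma GDERIV_grad:
  fixes f :: "'a::euclidean_space \<Rightarrow> real"
  assumes "f differentiable (at x)"
  shows "GDERIV f x :> grad f x"
proof -
  obtain f' where f': "FDERIV f x :> f'"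
    using assms by (auto simp: differentiable_def)
  have "f' h = inner h (adjoint f' 1)" for h
    using adjoint_works[OF has_derivative_linear[OF f'], of h 1]
    by simp
  then have "f' = (\<lambda>h. inner h (adjoint f' 1))" by blast
  with f' have g: "GDERIV f x :> adjoint f' 1"
    unfolding gderiv_def by metis
  have "d = adjoint f' 1" if "GDERIV f x :> d" for d
  proof -
    have "(\<lambda>h. inner h d) = (\<lambda>h. inner h (adjoint f' 1))"
      using that g unfolding gderiv_def by (rule has_derivative_unique)
    then show ?thesis
      unfolding fun_eq_iff by (rule vector_eq_ldot[THEN iffD1])
  qed
  with g show ?thesis
    unfolding grad_def by (rule theI)
qed

text \<open>Along the segment from \<open>x\<close> to \<open>y\<close>, \<open>f\<close> minus its
  quadratic model has nonpositive derivative, by Cauchy-Schwarz and the Lipschitz bound on the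
  gradient.\<close>

lemma lipschitz_gradient_quadratic_bound:
  fixes f :: "'a::real_inner \<Rightarrow> real"
  assumes deriv: "\<And>x. GDERIV f x :> f' x"
    and lip: "\<And>x y. norm (f' y - f' x) \<le> L * norm (y - x)"
  shows "f y \<le> f x + f' x \<bullet> (y - x) + L / 2 * (norm (y - x))\<^sup>2"
proof -
  define d where "d = y - x"
  define \<phi> where "\<phi> t = f (x + t *\<^sub>R d) - t * (f' x \<bullet> d) - L / 2 * t\<^sup>2 * (norm d)\<^sup>2" for t
  have der: "(\<phi> has_real_derivative
      d \<bullet> f' (x + t *\<^sub>R d) - f' x \<bullet> d - L * t * (norm d)\<^sup>2) (at t)" for t
  proof -
    have "((\<lambda>t. x + t *\<^sub>R d) has_derivative (\<lambda>s. s *\<^sub>R d)) (at t)"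
      by (auto intro!: derivative_eq_intros)
    from has_derivative_compose[OF this deriv[unfolded gderiv_def]]
    have "((\<lambda>t. f (x + t *\<^sub>R d)) has_real_derivative d \<bullet> f' (x + t *\<^sub>R d)) (at t)"
      by (simp add: has_field_derivative_def mult_commute_abs)
    then show ?thesis
      unfolding \<phi>_def by (auto intro!: derivative_eq_intros)
  qed
  have "\<phi> 1 \<le> \<phi> 0"
  proof (rule DERIV_nonpos_imp_nonincreasing[where f = \<phi> and a = 0 and b = 1])
    fix t :: real assume t: "0 \<le> t" "t \<le> 1"
    have "d \<bullet> f' (x + t *\<^sub>R d) - f' x \<bullet> d = d \<bullet> (f' (x + t *\<^sub>R d) - f' x)"
      by (simp add: inner_diff_right inner_commute)
    also have "\<dots> \<le> norm d * norm (f' (x + t *\<^sub>R d) - f' x)"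
      by (rule norm_cauchy_schwarz)
    also have "\<dots> \<le> norm d * (L * (t * norm d))"
      using lip[of "x + t *\<^sub>R d" x] t by (intro mult_left_mono) auto
    finally have "d \<bullet> f' (x + t *\<^sub>R d) - f' x \<bullet> d - L * t * (norm d)\<^sup>2 \<le> 0"
      by (simp add: power2_eq_square algebra_simps)
    with der show "\<exists>z. DERIV \<phi> t :> z \<and> z \<le> 0" by blast
  qed simp
  then show ?thesis
    by (simp add: \<phi>_def d_def)
qed

section \<open>Clipping as projection onto a ball\<close>

lemma clip_eq:
  assumes "norm g \<le> h" shows "clip h g = g"
  using assms by (cases "g = 0") (auto simp: clip_def min_def divide_simps)

lemma norm_clip_le:
  assumes "h > 0" shows "norm (clip h g) \<le> h"
  using assms by (cases "g = 0") (auto simp: clip_def min_def field_simps)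

lemma norm_clip_diff_self_le:
  assumes "h > 0"
  shows "norm (clip h g - g) \<le> max 0 (norm g - h)"
proof (cases "norm g \<le> h")
  case False
  then have g: "g \<noteq> 0" "h / norm g < 1" using assms by (auto simp: divide_simps)
  then have "clip h g - g = - ((1 - h / norm g) *\<^sub>R g)"
    by (simp add: clip_def algebra_simps)
  then have "norm (clip h g - g) = (1 - h / norm g) * norm g"
    using g by simp
  then show ?thesis using g by (simp add: algebra_simps)
qed (simp add: clip_eq)

text \<open>\<open>clip h\<close> is the metric projection onto the ball of radius \<open>h\<close>,
  and projection onto a convex set never increases the distance to a point of that set.\<close>

lemma norm_clip_diff_le:
  fixes g v :: "'a::real_inner"
  assumes "h > 0" "norm v \<le> h"
  shows "norm (clip h g - v) \<le> norm (g - v)"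
proof (cases "norm g \<le> h")
  case False
  define r where "r = h / norm g"
  have r: "0 < r" "r < 1" "r * norm g = h" and clip: "clip h g = r *\<^sub>R g"
    using False assms by (auto simp: r_def clip_def divide_simps)
  have "g \<bullet> v \<le> norm g * h"
    using norm_cauchy_schwarz[of g v] assms by (meson mult_left_mono norm_ge_zero order_trans)
  then have "2 * (g \<bullet> v) \<le> 2 * r * (norm g)\<^sup>2"
    unfolding r(3)[symmetric] power2_eq_square by (simp add: algebra_simps)
  also have "\<dots> \<le> (1 + r) * (norm g)\<^sup>2"
    using r by (intro mult_right_mono) auto
  \<comment> \<open>This product is the difference of the squared distances from \<open>v\<close> to
    \<open>g\<close> and from \<open>v\<close> to its projection.\<close>
  finally have "0 \<le> (1 - r) * ((1 + r) * (norm g)\<^sup>2 - 2 * (g \<bullet> v))"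
    using r by (intro mult_nonneg_nonneg) auto
  also have "\<dots> = (norm (g - v))\<^sup>2 - (norm (r *\<^sub>R g - v))\<^sup>2"
    unfolding power2_norm_eq_inner
    by (simp add: inner_diff inner_commute algebra_simps power2_eq_square)
  finally have "(norm (r *\<^sub>R g - v))\<^sup>2 \<le> (norm (g - v))\<^sup>2"
    by (rule diff_ge_0_iff_ge[THEN iffD1])
  then show ?thesis
    unfolding clip by (rule power2_le_imp_le) (rule norm_ge_zero)
qed (simp add: clip_eq)

lemma borel_measurable_clip [measurable]:
  "clip h \<in> borel_measurable (borel :: 'a::euclidean_space measure)"
  unfolding clip_def by measurable

text \<open>Approximating the continuous variable by simple functions leaves only countably many
  sections.\<close>
lemma borel_measurable_caratheodory:
  fixes g :: "'a::{metric_space, second_countable_topology} \<Rightarrow> 'b \<Rightarrow> 'c::metric_space"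
  assumes meas: "\<And>x. g x \<in> borel_measurable D"
    and cont: "\<And>\<xi>. \<xi> \<in> space D \<Longrightarrow> continuous_on UNIV (\<lambda>x. g x \<xi>)"
  shows "(\<lambda>(x, \<xi>). g x \<xi>) \<in> borel_measurable (borel \<Otimes>\<^sub>M D)"
proof -
  obtain s where s: "\<And>i. simple_function borel (s i)" and lim: "\<And>x::'a. (\<lambda>i. s i x) \<longlonglongrightarrow> x"
    using borel_measurable_implies_sequence_metric[of "\<lambda>x::'a. x" borel]
    by simp metis
  show ?thesis
  proof (rule borel_measurable_LIMSEQ_metric)
    show "(\<lambda>z. g (s i (fst z)) (snd z)) \<in> borel_measurable (borel \<Otimes>\<^sub>M D)" for i
    proof (rule measurable_compose_countable'[where I = "range (s i)"])
      show "(\<lambda>z. s i (fst z)) \<in> borel \<Otimes>\<^sub>M D \<rightarrow>\<^sub>M count_space (range (s i))"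
        using measurable_compose[OF measurable_fst measurable_simple_function[OF s[of i]]]
          simple_functionD(1)[OF s[of i]]
        by (auto simp: measurable_count_space_eq2 measurable_def)
      show "countable (range (s i))"
        using simple_functionD(1)[OF s[of i]] by (simp add: countable_finite)
    qed (use meas in measurable)
    show "(\<lambda>i. g (s i (fst z)) (snd z)) \<longlonglongrightarrow> (case z of (x, \<xi>) \<Rightarrow> g x \<xi>)"
      if "z \<in> space (borel \<Otimes>\<^sub>M D)" for z
    proof -
      obtain x \<xi> where z: "z = (x, \<xi>)" "\<xi> \<in> space D"
        using \<open>z \<in> space (borel \<Otimes>\<^sub>M D)\<close> by (auto simp: space_pair_measure)
      have "isCont (\<lambda>x. g x \<xi>) x"
        using cont[OF z(2)] by (simp add: continuous_on_eq_continuous_at)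
      from isCont_tendsto_compose[OF this lim] show ?thesis
        by (simp add: z(1))
    qed
  qed
qed

subsection \<open>Independence of the state and the next sample\<close>

text \<open>Unrolling the recursion makes the state a measurable function of the first
  \<open>t\<close> samples. Independence of disjoint blocks of samples can then be passed on to the
  state.\<close>

lemma (in prob_space) measurable_history:
  assumes X: "\<And>i. i \<ge> 1 \<Longrightarrow> random_variable D (X i)"
    and init: "\<And>s. s \<in> space M \<Longrightarrow> S 0 s = c" and c: "c \<in> space N"
    and step: "\<And>t s. s \<in> space M \<Longrightarrow> S (Suc t) s = step (S t s) (X (Suc t) s)"
    and meas: "(\<lambda>(x, \<xi>). step x \<xi>) \<in> N \<Otimes>\<^sub>M D \<rightarrow>\<^sub>M N"
  shows "\<exists>G \<in> PiM {1..t} (\<lambda>_. D) \<rightarrow>\<^sub>M N. \<forall>s\<in>space M. S t s = G (\<lambda>i\<in>{1..t}. X i s)"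
proof (induction t)
  case 0
  show ?case
    using init c by (intro bexI[of _ "\<lambda>_. c"]) auto
next
  case (Suc t)
  then obtain G where G: "G \<in> PiM {1..t} (\<lambda>_. D) \<rightarrow>\<^sub>M N"
    "\<And>s. s \<in> space M \<Longrightarrow> S t s = G (\<lambda>i\<in>{1..t}. X i s)"
    by blast
  let ?H = "\<lambda>x. step (G (restrict x {1..t})) (x (Suc t))"
  have "(\<lambda>x. (G (restrict x {1..t}), x (Suc t))) \<in> PiM {1..Suc t} (\<lambda>_. D) \<rightarrow>\<^sub>M N \<Otimes>\<^sub>M D"
    by (intro measurable_Pair measurable_compose[OF _ G(1)] measurable_restrict_subset
        measurable_component_singleton) auto
  from measurable_compose[OF this meas] have H: "?H \<in> PiM {1..Suc t} (\<lambda>_. D) \<rightarrow>\<^sub>M N"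
    by simp
  have eq: "S (Suc t) s = ?H (\<lambda>i\<in>{1..Suc t}. X i s)" if "s \<in> space M" for s
  proof -
    have "restrict (\<lambda>i\<in>{1..Suc t}. X i s) {1..t} = (\<lambda>i\<in>{1..t}. X i s)"
      by auto
    then show ?thesis using step G(2) that by simp
  qed
  show ?case
    by (rule bexI[OF _ H]) (intro ballI eq)
qed

text \<open>Independence of \<open>S t\<close> and \<open>X (Suc t)\<close> is stated through the joint distribution because
  \<open>indep_var\<close> requires both variables to take values in the same type.\<close>
lemma (in prob_space) state_sample_joint_distr:
  assumes X: "indep_vars (\<lambda>_. D) X {1..}"
    and init: "\<And>s. s \<in> space M \<Longrightarrow> S 0 s = c" and c: "c \<in> space N"
    and step: "\<And>t s. s \<in> space M \<Longrightarrow> S (Suc t) s = step (S t s) (X (Suc t) s)"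
    and meas: "(\<lambda>(x, \<xi>). step x \<xi>) \<in> N \<Otimes>\<^sub>M D \<rightarrow>\<^sub>M N"
  shows "random_variable N (S t)"
    and "distr M (N \<Otimes>\<^sub>M D) (\<lambda>s. (S t s, X (Suc t) s)) = distr M N (S t) \<Otimes>\<^sub>M distr M D (X (Suc t))"
proof -
  have rv: "random_variable D (X i)" if "i \<ge> 1" for i
    using X that by (auto simp: indep_vars_def)
  obtain G where G: "G \<in> PiM {1..t} (\<lambda>_. D) \<rightarrow>\<^sub>M N"
    "\<And>s. s \<in> space M \<Longrightarrow> S t s = G (\<lambda>i\<in>{1..t}. X i s)"
    using measurable_history[OF rv init c step meas] by metis
  let ?R = "\<lambda>A s. restrict (\<lambda>i. X i s) A"
  \<comment> \<open>The past and the next sample are disjoint blocks of the sequence. The joint law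
    of the blocks is pushed forward by \<open>G\<close> on the past and by evaluation at
    \<open>Suc t\<close> on the one-element block.\<close>
  have "indep_var (PiM {1..t} (\<lambda>_. D)) (?R {1..t}) (PiM {Suc t} (\<lambda>_. D)) (?R {Suc t})"
    by (rule indep_var_restrict[OF X]) auto
  then have R: "random_variable (PiM {1..t} (\<lambda>_. D)) (?R {1..t})"
      "random_variable (PiM {Suc t} (\<lambda>_. D)) (?R {Suc t})"
    and joint: "distr M (PiM {1..t} (\<lambda>_. D)) (?R {1..t}) \<Otimes>\<^sub>M distr M (PiM {Suc t} (\<lambda>_. D)) (?R {Suc t})
      = distr M (PiM {1..t} (\<lambda>_. D) \<Otimes>\<^sub>M PiM {Suc t} (\<lambda>_. D)) (\<lambda>s. (?R {1..t} s, ?R {Suc t} s))"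
    by (simp_all add: indep_var_distribution_eq)
  have ev: "(\<lambda>x. x (Suc t)) \<in> PiM {Suc t} (\<lambda>_. D) \<rightarrow>\<^sub>M D"
    by (rule measurable_component_singleton) simp
  have GE: "(\<lambda>(x, y). (G x, y (Suc t)))
      \<in> PiM {1..t} (\<lambda>_. D) \<Otimes>\<^sub>M PiM {Suc t} (\<lambda>_. D) \<rightarrow>\<^sub>M N \<Otimes>\<^sub>M D"
    unfolding case_prod_beta'
    by (intro measurable_Pair measurable_compose[OF measurable_fst G(1)]
        measurable_compose[OF measurable_snd ev])
  have dS: "distr M N (S t) = distr (distr M (PiM {1..t} (\<lambda>_. D)) (?R {1..t})) N G"
    unfolding distr_distr[OF G(1) R(1)] using G(2) by (intro distr_cong) (simp_all add: o_def)
  have dX: "distr M D (X (Suc t)) = distr (distr M (PiM {Suc t} (\<lambda>_. D)) (?R {Suc t})) D (\<lambda>x. x (Suc t))"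
    unfolding distr_distr[OF ev R(2)] by (intro distr_cong) (simp_all add: o_def)
  show "random_variable N (S t)"
    using measurable_compose[OF R(1) G(1)] G(2) by (simp cong: measurable_cong)
  have "prob_space (distr M D (X (Suc t)))"
    using rv by (intro prob_space_distr) auto
  then have sf: "sigma_finite_measure (distr (distr M (PiM {Suc t} (\<lambda>_. D)) (?R {Suc t})) D (\<lambda>x. x (Suc t)))"
    unfolding dX by (rule prob_space_imp_sigma_finite)
  have "distr M N (S t) \<Otimes>\<^sub>M distr M D (X (Suc t))
      = distr (distr M (PiM {1..t} (\<lambda>_. D) \<Otimes>\<^sub>M PiM {Suc t} (\<lambda>_. D)) (\<lambda>s. (?R {1..t} s, ?R {Suc t} s)))
          (N \<Otimes>\<^sub>M D) (\<lambda>(x, y). (G x, y (Suc t)))"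
    unfolding dS dX joint[symmetric] 
    by (rule pair_measure_distr[OF _ _ sf]; unfold measurable_distr_eq1; rule G ev)
  also have "\<dots> = distr M (N \<Otimes>\<^sub>M D) (\<lambda>s. (S t s, X (Suc t) s))"
    unfolding distr_distr[OF GE measurable_Pair[OF R]] using G(2)
    by (intro distr_cong) (simp_all add: o_def)
  finally show "distr M (N \<Otimes>\<^sub>M D) (\<lambda>s. (S t s, X (Suc t) s))
      = distr M N (S t) \<Otimes>\<^sub>M distr M D (X (Suc t))"
    by (rule sym)
qed

text \<open>Tonelli for a product law: the next sample is averaged out with the state frozen. This
  takes the place of conditional expectation given the past.\<close>

lemma (in prob_space) nn_integral_state_sample:
  assumes S: "random_variable N S" and X: "random_variable D X" and D: "distr M D X = D"
    and joint: "distr M (N \<Otimes>\<^sub>M D) (\<lambda>s. (S s, X s)) = distr M N S \<Otimes>\<^sub>M distr M D X"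
    and \<phi>: "(\<lambda>(x, \<xi>). \<phi> x \<xi>) \<in> borel_measurable (N \<Otimes>\<^sub>M D)"
  shows "(\<integral>\<^sup>+s. \<phi> (S s) (X s) \<partial>M) = (\<integral>\<^sup>+s. (\<integral>\<^sup>+\<xi>. \<phi> (S s) \<xi> \<partial>D) \<partial>M)"
proof -
  interpret D: prob_space D
    using prob_space_distr[OF X] unfolding D .
  have SX: "(\<lambda>s. (S s, X s)) \<in> M \<rightarrow>\<^sub>M N \<Otimes>\<^sub>M D"
    using S X by (rule measurable_Pair)
  have "(\<integral>\<^sup>+s. \<phi> (S s) (X s) \<partial>M) = (\<integral>\<^sup>+z. (case z of (x, \<xi>) \<Rightarrow> \<phi> x \<xi>) \<partial>(distr M N S \<Otimes>\<^sub>M D))"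
    using nn_integral_distr[OF SX, of "\<lambda>(x, \<xi>). \<phi> x \<xi>"] joint D \<phi> by simp
  also have "\<dots> = (\<integral>\<^sup>+x. (\<integral>\<^sup>+\<xi>. \<phi> x \<xi> \<partial>D) \<partial>distr M N S)"
    using \<phi> by (subst D.nn_integral_fst[symmetric]) (auto cong: measurable_cong_sets)
  also have "\<dots> = (\<integral>\<^sup>+s. (\<integral>\<^sup>+\<xi>. \<phi> (S s) \<xi> \<partial>D) \<partial>M)"
    using D.borel_measurable_nn_integral_fst[OF \<phi>] by (subst nn_integral_distr[OF S]) auto
  finally show ?thesis .
qed

subsection \<open>Clipped stochastic gradients\<close>

text \<open>Everything about a single sample concerns only the random field \<open>g\<close> and its
  mean \<open>gf\<close>; the objective enters later.\<close>

locale stochastic_gradient = prob_space D for D :: "'x measure" +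
  fixes g :: "'v::euclidean_space \<Rightarrow> 'x \<Rightarrow> 'v" and gf :: "'v \<Rightarrow> 'v" and L \<sigma> p :: real
  assumes lipschitz: "\<And>\<xi> x y. \<xi> \<in> space D \<Longrightarrow> norm (g y \<xi> - g x \<xi>) \<le> L * norm (y - x)"
    and mean: "\<And>w. has_bochner_integral D (g w) (gf w)"
    and noise: "\<And>w. (\<integral>\<^sup>+\<xi>. ennreal (norm (g w \<xi> - gf w) powr p) \<partial>D) \<le> ennreal (\<sigma> powr p)"
    and L_pos: "L > 0" and \<sigma>_pos: "\<sigma> > 0" and p: "1 < p" "p \<le> 2"
begin

lemma integrable_g: "integrable D (g w)"
  using mean by (rule integrable.intros)

lemma measurable_g [measurable]: "g w \<in> borel_measurable D"
  using integrable_g by (rule borel_measurable_integrable)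

lemma gf_eq: "gf w = (\<integral>\<xi>. g w \<xi> \<partial>D)"
  using has_bochner_integral_integral_eq[OF mean] by simp

lemma gf_lipschitz: "norm (gf y - gf x) \<le> L * norm (y - x)"
proof -
  have "norm (gf y - gf x) = norm (\<integral>\<xi>. g y \<xi> - g x \<xi> \<partial>D)"
    by (simp add: gf_eq integrable_g)
  also have "\<dots> \<le> (\<integral>\<xi>. norm (g y \<xi> - g x \<xi>) \<partial>D)"
    by (rule integral_norm_bound)
  also have "\<dots> \<le> (\<integral>\<xi>. L * norm (y - x) \<partial>D)"
    by (intro integral_mono) (auto intro!: lipschitz integrable_g integrable_norm Bochner_Integration.integrable_diff)
  finally show ?thesis by (simp add: prob_space)
qed

lemma continuous_gf: "continuous_on UNIV gf"
proof -
  have "L-lipschitz_on UNIV gf"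
    using gf_lipschitz L_pos by (intro lipschitz_onI) (auto simp: dist_norm)
  then show ?thesis by (rule lipschitz_on_continuous_on)
qed

lemma measurable_gf [measurable]: "gf \<in> borel_measurable borel"
  using continuous_gf by (rule borel_measurable_continuous_onI)

text \<open>A run evaluates the gradient at a random point and a random sample, which calls for
  joint measurability. Lipschitz continuity in the point supplies it.\<close>

lemma measurable_g_pair: "(\<lambda>(x, \<xi>). g x \<xi>) \<in> borel_measurable (borel \<Otimes>\<^sub>M D)"
proof (rule borel_measurable_caratheodory)
  fix \<xi> assume "\<xi> \<in> space D"
  then have "L-lipschitz_on UNIV (\<lambda>x. g x \<xi>)"
    using lipschitz L_pos by (intro lipschitz_onI) (auto simp: dist_norm)
  then show "continuous_on UNIV (\<lambda>x. g x \<xi>)" by (rule lipschitz_on_continuous_on)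
qed simp

lemma measurable_g_comp [measurable (raw)]:
  assumes "a \<in> borel_measurable N" "b \<in> N \<rightarrow>\<^sub>M D"
  shows "(\<lambda>x. g (a x) (b x)) \<in> borel_measurable N"
  using measurable_compose[OF measurable_Pair[OF assms] measurable_g_pair] by simp

lemma noise_integrable: "integrable D (\<lambda>\<xi>. norm (g w \<xi> - gf w) powr p)"
proof (rule integrableI_bounded)
  show "(\<integral>\<^sup>+\<xi>. ennreal (norm (norm (g w \<xi> - gf w) powr p)) \<partial>D) < \<infinity>"
    using noise[of w] by (simp add: order_le_less_trans[OF _ ennreal_less_top])
qed measurable

lemma noise_integral: "(\<integral>\<xi>. norm (g w \<xi> - gf w) powr p \<partial>D) \<le> \<sigma> powr p"
  using noise[of w] nn_integral_eq_integral[OF noise_integrable[of w]]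
  by (simp add: ennreal_le_iff)

section \<open>Bias and second moment of the clipped gradient\<close>

definition clip_mean :: "real \<Rightarrow> 'v \<Rightarrow> 'v" where
  "clip_mean h w = (\<integral>\<xi>. clip h (g w \<xi>) \<partial>D)"

lemma measurable_clip_mean [measurable]: "clip_mean h \<in> borel_measurable borel"
  unfolding clip_mean_def by measurable

lemma integrable_clip: "h > 0 \<Longrightarrow> integrable D (\<lambda>\<xi>. clip h (g w \<xi>))"
  by (rule integrable_const_bound[of _ h]) (auto simp: norm_clip_le)

text \<open>Only samples with gradient norm above \<open>h\<close> are changed, and these lie at
  distance at least \<open>h / 2\<close> from \<open>gf w\<close>. Since \<open>1 - p < 0\<close>,
  their distance is at most its \<open>p\<close>-th power times
  \<open>(h / 2) powr (1 - p)\<close>.\<close>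

lemma clip_bias:
  assumes h: "h > 0" and w: "norm (gf w) \<le> h / 2"
  shows "norm (clip_mean h w - gf w) \<le> \<sigma> powr p * (h / 2) powr (1 - p)"
proof -
  have pt: "norm (clip h (g w \<xi>) - g w \<xi>) \<le> norm (g w \<xi> - gf w) powr p * (h / 2) powr (1 - p)"
    for \<xi>
  proof (cases "norm (g w \<xi>) \<le> h")
    case False
    let ?n = "norm (g w \<xi> - gf w)"
    have n: "norm (g w \<xi>) - h / 2 \<le> ?n"
      using norm_triangle_ineq2[of "g w \<xi>" "gf w"] w by linarith
    then have n2: "h / 2 \<le> ?n" using False by linarith
    have "norm (clip h (g w \<xi>) - g w \<xi>) \<le> ?n"
      using norm_clip_diff_self_le[OF h, of "g w \<xi>"] n h False by linarith
    also have "?n = ?n powr p * ?n powr (1 - p)"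
      using n2 h by (simp flip: powr_add)
    also have "\<dots> \<le> ?n powr p * (h / 2) powr (1 - p)"
      using n2 h p by (intro mult_left_mono powr_mono2') auto
    finally show ?thesis .
  qed (simp add: clip_eq)
  have "norm (clip_mean h w - gf w) = norm (\<integral>\<xi>. clip h (g w \<xi>) - g w \<xi> \<partial>D)"
    unfolding clip_mean_def gf_eq by (simp add: integrable_clip[OF h] integrable_g)
  also have "\<dots> \<le> (\<integral>\<xi>. norm (clip h (g w \<xi>) - g w \<xi>) \<partial>D)"
    by (rule integral_norm_bound)
  also have "\<dots> \<le> (\<integral>\<xi>. norm (g w \<xi> - gf w) powr p * (h / 2) powr (1 - p) \<partial>D)"
    using pt by (intro integral_mono)
      (auto intro!: integrable_norm Bochner_Integration.integrable_diff
        integrable_clip[OF h] integrable_g noise_integrable)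
  also have "\<dots> \<le> \<sigma> powr p * (h / 2) powr (1 - p)"
    using noise_integral[of w] by (simp add: mult_right_mono)
  finally show ?thesis .
qed

text \<open>Interpolation: \<open>2 - p\<close> of the two powers are paid by the sure bound
  \<open>3 * h / 2\<close>, the other \<open>p\<close> by the noise. The unclipped noise may have
  infinite variance.\<close>

lemma clip_second_moment:
  assumes h: "h > 0" and w: "norm (gf w) \<le> h / 2"
  shows "(\<integral>\<xi>. (norm (clip h (g w \<xi>) - gf w))\<^sup>2 \<partial>D) \<le> \<sigma> powr p * (3 * h / 2) powr (2 - p)"
proof -
  have pt: "(norm (clip h (g w \<xi>) - gf w))\<^sup>2
      \<le> norm (g w \<xi> - gf w) powr p * (3 * h / 2) powr (2 - p)" for \<xi>
  proof (cases "clip h (g w \<xi>) = gf w")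
    case False
    let ?x = "norm (clip h (g w \<xi>) - gf w)"
    have "?x \<le> norm (g w \<xi> - gf w)"
      using norm_clip_diff_le[OF h, of "gf w"] h w by auto
    moreover have "?x \<le> 3 * h / 2"
      using norm_triangle_ineq4[of "clip h (g w \<xi>)" "gf w"] norm_clip_le[OF h, of "g w \<xi>"] w
      by linarith
    moreover have "?x\<^sup>2 = ?x powr p * ?x powr (2 - p)"
      using False by (simp flip: powr_add)
    ultimately show ?thesis
      using p by (auto intro!: mult_mono powr_mono2)
  qed simp
  have "(\<integral>\<xi>. (norm (clip h (g w \<xi>) - gf w))\<^sup>2 \<partial>D)
      \<le> (\<integral>\<xi>. norm (g w \<xi> - gf w) powr p * (3 * h / 2) powr (2 - p) \<partial>D)"
    using pt by (intro integral_mono' ) (auto intro!: noise_integrable)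
  also have "\<dots> \<le> \<sigma> powr p * (3 * h / 2) powr (2 - p)"
    using noise_integral[of w] by (simp add: mult_right_mono)
  finally show ?thesis .
qed

end

text \<open>Pythagoras in mean square: a centred variable is orthogonal to constants. The second
  part is this identity; the first follows from it by dropping the squared norm of the mean.\<close>

lemma (in prob_space) second_moment_centered:
  fixes Y :: "'a \<Rightarrow> 'b::euclidean_space"
  assumes Y: "integrable M Y" "integrable M (\<lambda>x. (norm (Y x))\<^sup>2)"
  shows "expectation (\<lambda>x. (norm (Y x - expectation Y))\<^sup>2) \<le> expectation (\<lambda>x. (norm (Y x))\<^sup>2)"
    and "expectation (\<lambda>x. (norm (c + (Y x - expectation Y)))\<^sup>2)
      = (norm c)\<^sup>2 + expectation (\<lambda>x. (norm (Y x - expectation Y))\<^sup>2)"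
proof -
  define e where "e = expectation Y"
  have lin: "integrable M (\<lambda>x. v \<bullet> Y x)" "expectation (\<lambda>x. v \<bullet> Y x) = v \<bullet> e" for v
    unfolding e_def using Y(1) by (rule integrable_inner_right integral_inner_right)+
  have 1: "(norm (Y x - e))\<^sup>2 = (norm (Y x))\<^sup>2 - 2 * (e \<bullet> Y x) + (norm e)\<^sup>2" for x
    unfolding power2_norm_eq_inner by (simp add: inner_diff inner_commute)
  have int: "integrable M (\<lambda>x. (norm (Y x - e))\<^sup>2)"
    unfolding 1 using Y lin by simp
  have "expectation (\<lambda>x. (norm (Y x - e))\<^sup>2) = expectation (\<lambda>x. (norm (Y x))\<^sup>2) - (norm e)\<^sup>2"
    unfolding 1 using Y lin by (simp add: prob_space power2_norm_eq_inner)
  then show "expectation (\<lambda>x. (norm (Y x - expectation Y))\<^sup>2) \<le> expectation (\<lambda>x. (norm (Y x))\<^sup>2)"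
    by (simp add: e_def)
  have 2: "(norm (c + (Y x - e)))\<^sup>2 = (norm c)\<^sup>2 + 2 * (c \<bullet> Y x) - 2 * (c \<bullet> e) + (norm (Y x - e))\<^sup>2"
    for x
    unfolding power2_norm_eq_inner by (simp add: inner_diff inner_add inner_commute)
  have "expectation (\<lambda>x. (norm (c + (Y x - e)))\<^sup>2)
      = (norm c)\<^sup>2 + expectation (\<lambda>x. (norm (Y x - e))\<^sup>2)"
    unfolding 2 using Y int lin by (simp add: prob_space)
  then show "expectation (\<lambda>x. (norm (c + (Y x - expectation Y)))\<^sup>2)
      = (norm c)\<^sup>2 + expectation (\<lambda>x. (norm (Y x - expectation Y))\<^sup>2)"
    by (simp add: e_def)
qed

section \<open>Centred increments of the momentum error\<close>

context stochastic_gradient begin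

text \<open>The forcing term of the momentum error minus its mean over the sample, with the iterates
  \<open>w\<close> and \<open>w'\<close> fixed. Clipping is centred at \<open>clip_mean\<close>, so
  its bias is accounted for separately.\<close>

definition deviation :: "real \<Rightarrow> real \<Rightarrow> 'v \<Rightarrow> 'v \<Rightarrow> 'x \<Rightarrow> 'v" where
  "deviation h \<theta> w w' \<xi> = (1 - \<theta>) *\<^sub>R (clip h (g w \<xi>) - clip_mean h w)
     + \<theta> *\<^sub>R (g w \<xi> - g w' \<xi> - (gf w - gf w'))"

definition deviation_bound :: "real \<Rightarrow> real \<Rightarrow> real \<Rightarrow> real" where
  "deviation_bound h \<theta> \<gamma> =
     2 * (1 - \<theta>)\<^sup>2 * (\<sigma> powr p * (3 * h / 2) powr (2 - p)) + 2 * (L * \<gamma>)\<^sup>2"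

lemma measurable_deviation [measurable (raw)]:
  assumes [measurable]: "a \<in> borel_measurable N" "a' \<in> borel_measurable N" "b \<in> N \<rightarrow>\<^sub>M D"
  shows "(\<lambda>x. deviation h \<theta> (a x) (a' x) (b x)) \<in> borel_measurable N"
  unfolding deviation_def by measurable

text \<open>Here \<open>c\<close> stands for the error inherited from the past; a centred increment
  has no cross term with it. The factor 2 in the bound comes from splitting the square of a sum. The
  nonnegative integral allows the estimate to be inserted under the integral over the run.\<close>

lemma deviation_second_moment:
  assumes h: "h > 0" and w: "norm (gf w) \<le> h / 2" and ww': "norm (w - w') \<le> \<gamma>"
    and \<theta>: "0 \<le> \<theta>" "\<theta> < 1"
  shows "(\<integral>\<^sup>+\<xi>. ennreal ((norm (c + deviation h \<theta> w w' \<xi>))\<^sup>2) \<partial>D)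
    \<le> ennreal ((norm c)\<^sup>2 + deviation_bound h \<theta> \<gamma>)"
proof -
  \<comment> \<open>\<open>Y\<close> differs from \<open>deviation\<close> by a constant and
    compares the clipped gradient with \<open>gf w\<close>, for which a second-moment bound is at
    hand. Centring can only decrease the second moment.\<close>
  define Y where "Y \<xi> = (1 - \<theta>) *\<^sub>R (clip h (g w \<xi>) - gf w) + \<theta> *\<^sub>R (g w \<xi> - g w' \<xi>)" for \<xi>
  have [measurable]: "Y \<in> borel_measurable D"
    unfolding Y_def by measurable
  have Y_int: "integrable D Y"
    unfolding Y_def using integrable_clip[OF h] integrable_g by simp
  have EY: "expectation Y = (1 - \<theta>) *\<^sub>R (clip_mean h w - gf w) + \<theta> *\<^sub>R (gf w - gf w')"
    unfolding Y_def clip_mean_def gf_eq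
    using integrable_clip[OF h] integrable_g by (simp add: prob_space)
  have dev: "deviation h \<theta> w w' \<xi> = Y \<xi> - expectation Y" for \<xi>
    unfolding EY Y_def deviation_def by (simp add: algebra_simps)
  define x where "x \<xi> = norm (clip h (g w \<xi>) - gf w)" for \<xi>
  have [measurable]: "x \<in> borel_measurable D"
    unfolding x_def by measurable
  have x_le: "x \<xi> \<le> 3 * h / 2" for \<xi>
    using norm_triangle_ineq4[of "clip h (g w \<xi>)" "gf w"] norm_clip_le[OF h, of "g w \<xi>"] w
    by (simp add: x_def)
  have x_int: "integrable D (\<lambda>\<xi>. (x \<xi>)\<^sup>2)"
    using x_le by (intro integrable_const_bound[of _ "(3 * h / 2)\<^sup>2"])
      (auto intro!: power_mono simp: x_def simp del: power_divide power_mult_distrib)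
  have Y_le: "(norm (Y \<xi>))\<^sup>2 \<le> 2 * (1 - \<theta>)\<^sup>2 * (x \<xi>)\<^sup>2 + 2 * (L * \<gamma>)\<^sup>2" if "\<xi> \<in> space D" for \<xi>
  proof -
    have "norm (g w \<xi> - g w' \<xi>) \<le> L * \<gamma>"
      using lipschitz[OF that, of w w'] mult_left_mono[OF ww', of L] L_pos by linarith
    then have "\<theta> * norm (g w \<xi> - g w' \<xi>) \<le> 1 * (L * \<gamma>)"
      using \<theta> by (intro mult_mono) auto
    moreover have "norm (Y \<xi>) \<le> (1 - \<theta>) * x \<xi> + \<theta> * norm (g w \<xi> - g w' \<xi>)"
      unfolding Y_def x_def using \<theta> by (intro order_trans[OF norm_triangle_ineq]) auto
    ultimately have "norm (Y \<xi>) \<le> (1 - \<theta>) * x \<xi> + L * \<gamma>"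
      by linarith
    then have "(norm (Y \<xi>))\<^sup>2 \<le> ((1 - \<theta>) * x \<xi> + L * \<gamma>)\<^sup>2"
      by (intro power_mono) auto
    also have "\<dots> \<le> 2 * ((1 - \<theta>) * x \<xi>)\<^sup>2 + 2 * (L * \<gamma>)\<^sup>2"
      using sum_squares_bound[of "(1 - \<theta>) * x \<xi>" "L * \<gamma>"] by (simp add: power2_sum)
    finally show ?thesis by (simp add: power_mult_distrib)
  qed
  have Y2_int: "integrable D (\<lambda>\<xi>. (norm (Y \<xi>))\<^sup>2)"
    by (rule Bochner_Integration.integrable_bound[where f = "\<lambda>\<xi>. 2 * (1 - \<theta>)\<^sup>2 * (x \<xi>)\<^sup>2 + 2 * (L * \<gamma>)\<^sup>2"])
      (use x_int in \<open>auto intro!: AE_I2 order_trans[OF Y_le]\<close>)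
  have "expectation (\<lambda>\<xi>. (norm (Y \<xi>))\<^sup>2)
      \<le> expectation (\<lambda>\<xi>. 2 * (1 - \<theta>)\<^sup>2 * (x \<xi>)\<^sup>2 + 2 * (L * \<gamma>)\<^sup>2)"
    using Y2_int x_int Y_le by (intro integral_mono) auto
  also have "\<dots> = 2 * (1 - \<theta>)\<^sup>2 * expectation (\<lambda>\<xi>. (x \<xi>)\<^sup>2) + 2 * (L * \<gamma>)\<^sup>2"
    using x_int by (simp add: prob_space)
  also have "\<dots> \<le> deviation_bound h \<theta> \<gamma>"
    using clip_second_moment[OF h w] unfolding x_def deviation_bound_def
    by (intro add_right_mono mult_left_mono) auto
  finally have "expectation (\<lambda>\<xi>. (norm (c + deviation h \<theta> w w' \<xi>))\<^sup>2) \<le> (norm c)\<^sup>2 + deviation_bound h \<theta> \<gamma>"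
    unfolding dev using second_moment_centered[OF Y_int Y2_int] by simp
  moreover have "integrable D (\<lambda>\<xi>. (norm (c + deviation h \<theta> w w' \<xi>))\<^sup>2)"
  proof -
    have "(norm (c + deviation h \<theta> w w' \<xi>))\<^sup>2
        = (norm (c - expectation Y))\<^sup>2 + 2 * ((c - expectation Y) \<bullet> Y \<xi>) + (norm (Y \<xi>))\<^sup>2" for \<xi>
      unfolding dev power2_norm_eq_inner by (simp add: inner_diff inner_add inner_commute)
    then show ?thesis using Y_int Y2_int by simp
  qed
  ultimately show ?thesis
    by (subst nn_integral_eq_integral) (auto intro: ennreal_leI)
qed

end

subsection \<open>Momentum error and descent along a run\<close>

text \<open>Since a step has length at most \<open>\<gamma>\<close> and \<open>gf\<close> is
  \<open>L\<close>-Lipschitz, \<open>h_ge\<close> keeps every gradient norm up to time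
  \<open>T\<close> below half the clipping threshold.\<close>

locale nsgdc_vr_run = stochastic_gradient D g gf L \<sigma> p + M: prob_space M
  for D :: "'x measure" and g :: "'v::euclidean_space \<Rightarrow> 'x \<Rightarrow> 'v" and gf L \<sigma> p
    and M :: "'s measure" +
  fixes f :: "'v \<Rightarrow> real" and X :: "nat \<Rightarrow> 's \<Rightarrow> 'x" and w m :: "nat \<Rightarrow> 's \<Rightarrow> 'v"
    and w0 :: 'v and \<gamma> \<theta> h f_min :: real and T :: nat
  assumes gderiv: "\<And>x. GDERIV f x :> gf x" and f_min: "\<And>x. f_min \<le> f x"
    and samples_indep: "M.indep_vars (\<lambda>_. D) X {1..}"
    and samples_distr: "\<And>t. t \<ge> 1 \<Longrightarrow> distr M D (X t) = D"
    and w_0: "\<And>s. s \<in> space M \<Longrightarrow> w 0 s = w0" and w_1: "\<And>s. s \<in> space M \<Longrightarrow> w 1 s = w0"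
    and m_0: "\<And>s. s \<in> space M \<Longrightarrow> m 0 s = 0"
    and m_Suc: "\<And>t s. s \<in> space M \<Longrightarrow> m (Suc t) s = \<theta> *\<^sub>R m t s
      + (1 - \<theta>) *\<^sub>R clip h (g (w (Suc t) s) (X (Suc t) s))
      + \<theta> *\<^sub>R g (w (Suc t) s) (X (Suc t) s) - \<theta> *\<^sub>R g (w t s) (X (Suc t) s)"
    and w_Suc: "\<And>t s. s \<in> space M \<Longrightarrow> w (Suc (Suc t)) s = w (Suc t) s - \<gamma> *\<^sub>R sgn (m (Suc t) s)"
    and \<gamma>_pos: "\<gamma> > 0" and \<theta>: "0 \<le> \<theta>" "\<theta> < 1"
    and h_pos: "h > 0" and h_ge: "norm (gf w0) + L * \<gamma> * T \<le> h / 2" and T: "T \<ge> 1"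
begin

text \<open>The error \<open>m t - gf (w t)\<close> splits into \<open>fluct t\<close>, whose increments are centred given the past,
  and a remainder that is bounded surely.\<close>
primrec fluct :: "nat \<Rightarrow> 's \<Rightarrow> 'v" where
  "fluct 0 s = 0"
| "fluct (Suc t) s = \<theta> *\<^sub>R fluct t s + deviation h \<theta> (w (Suc t) s) (w t s) (X (Suc t) s)"

text \<open>These four components make the run a Markov chain driven by the samples, so that the present
  state is independent of the next sample.\<close>
definition state :: "nat \<Rightarrow> 's \<Rightarrow> 'v \<times> 'v \<times> 'v \<times> 'v" where
  "state t s = (w (Suc t) s, w t s, m t s, fluct t s)"

text \<open>The components \<open>a\<close> and \<open>a'\<close> are the two iterates at which the
  next sample is evaluated; the newer one is already determined before that sample is drawn.\<close>

definition state_step :: "'v \<times> 'v \<times> 'v \<times> 'v \<Rightarrow> 'x \<Rightarrow> 'v \<times> 'v \<times> 'v \<times> 'v" where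
  "state_step = (\<lambda>(a, a', b, u) \<xi>.
     let b' = \<theta> *\<^sub>R b + (1 - \<theta>) *\<^sub>R clip h (g a \<xi>) + \<theta> *\<^sub>R g a \<xi> - \<theta> *\<^sub>R g a' \<xi>
     in (a - \<gamma> *\<^sub>R sgn b', a, b', \<theta> *\<^sub>R u + deviation h \<theta> a a' \<xi>))"

lemma measurable_state_step: "(\<lambda>(x, \<xi>). state_step x \<xi>) \<in> borel \<Otimes>\<^sub>M D \<rightarrow>\<^sub>M borel"
  unfolding state_step_def Let_def sgn_div_norm
  by (simp add: borel_prod[symmetric] case_prod_beta')

lemma state_Suc: "s \<in> space M \<Longrightarrow> state (Suc t) s = state_step (state t s) (X (Suc t) s)"
  by (simp add: state_def state_step_def Let_def m_Suc w_Suc)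

lemma state_0: "s \<in> space M \<Longrightarrow> state 0 s = (w0, w0, 0, 0)"
  using w_1 by (simp add: state_def w_0 m_0)

lemmas state_joint = M.state_sample_joint_distr[where S = state and N = borel and step = state_step,
    OF samples_indep state_0 _ state_Suc measurable_state_step]

lemma measurable_state: "state t \<in> borel_measurable M"
  by (rule state_joint) auto

lemma measurable_w [measurable]: "w t \<in> borel_measurable M"
  using measurable_compose[OF measurable_state[of t], of "\<lambda>x. fst (snd x)"]
  by (simp add: state_def borel_prod[symmetric])

lemma measurable_fluct [measurable]: "fluct t \<in> borel_measurable M"
  using measurable_compose[OF measurable_state[of t], of "\<lambda>x. snd (snd (snd x))"]
  by (simp add: state_def borel_prod[symmetric])

lemma step_length:
  assumes "s \<in> space M" shows "norm (w (Suc t) s - w t s) \<le> \<gamma>"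
  using assms w_1[OF assms] \<gamma>_pos
  by (cases t) (auto simp: w_0 w_Suc norm_sgn)

lemma gradient_le:
  assumes "s \<in> space M" "t \<le> T" shows "norm (gf (w t s)) \<le> h / 2"
proof -
  have "norm (w t s - w0) \<le> \<gamma> * t"
  proof (induction t)
    case (Suc t)
    then show ?case
      using step_length[OF assms(1), of t] norm_triangle_ineq[of "w (Suc t) s - w t s" "w t s - w0"]
      by (simp add: algebra_simps)
  qed (simp add: w_0 assms)
  also have "\<dots> \<le> \<gamma> * T" using assms \<gamma>_pos by simp
  finally have "norm (gf (w t s) - gf w0) \<le> L * (\<gamma> * T)"
    using gf_lipschitz[of "w t s" w0] L_pos by (meson mult_left_mono order_trans less_imp_le)
  then show ?thesis
    using h_ge norm_triangle_sub[of "gf (w t s)" "gf w0"] by (simp add: mult.assoc)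
qed

text \<open>With the past frozen, the squared norms of \<open>\<theta> *\<^sub>R fluct t s\<close>
  and of the centred increment add up in mean. The bound is preserved because
  \<open>\<theta>\<^sup>2 \<le> \<theta>\<close> and \<open>K / (1 - \<theta>)\<close> is the fixed
  point of \<open>x \<mapsto> \<theta> * x + K\<close>.\<close>

lemma fluct_second_moment:
  assumes "t \<le> T"
  shows "(\<integral>\<^sup>+s. ennreal ((norm (fluct t s))\<^sup>2) \<partial>M) \<le> ennreal (deviation_bound h \<theta> \<gamma> / (1 - \<theta>))"
  using assms
proof (induction t)
  case 0
  show ?case by simp
next
  case (Suc t)
  let ?K = "deviation_bound h \<theta> \<gamma>"
  have K: "?K \<ge> 0" by (simp add: deviation_bound_def)
  define \<phi> where "\<phi> = (\<lambda>(a :: 'v, a', b :: 'v, u) \<xi>. ennreal ((norm (\<theta> *\<^sub>R u + deviation h \<theta> a a' \<xi>))\<^sup>2))"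
  have \<phi>: "(\<lambda>(x, \<xi>). \<phi> x \<xi>) \<in> borel_measurable (borel \<Otimes>\<^sub>M D)"
    unfolding \<phi>_def by (simp add: borel_prod[symmetric] case_prod_beta')
  have X: "X (Suc t) \<in> M \<rightarrow>\<^sub>M D"
    using samples_indep by (auto simp: M.indep_vars_def)
  have "(\<integral>\<^sup>+s. ennreal ((norm (fluct (Suc t) s))\<^sup>2) \<partial>M) = (\<integral>\<^sup>+s. \<phi> (state t s) (X (Suc t) s) \<partial>M)"
    by (simp add: \<phi>_def state_def)
  also have "\<dots> = (\<integral>\<^sup>+s. (\<integral>\<^sup>+\<xi>. \<phi> (state t s) \<xi> \<partial>D) \<partial>M)"
    by (rule M.nn_integral_state_sample[OF measurable_state X samples_distr state_joint(2) \<phi>]) auto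
  also have "\<dots> \<le> (\<integral>\<^sup>+s. ennreal (\<theta>\<^sup>2 * (norm (fluct t s))\<^sup>2 + ?K) \<partial>M)"
  proof (rule nn_integral_mono)
    fix s assume s: "s \<in> space M"
    show "(\<integral>\<^sup>+\<xi>. \<phi> (state t s) \<xi> \<partial>D) \<le> ennreal (\<theta>\<^sup>2 * (norm (fluct t s))\<^sup>2 + ?K)"
      using deviation_second_moment[OF h_pos gradient_le[OF s Suc.prems] step_length[OF s] \<theta>,
          of "\<theta> *\<^sub>R fluct t s"] \<theta>
      by (simp add: \<phi>_def state_def power_mult_distrib)
  qed
  also have "\<dots> = ennreal (\<theta>\<^sup>2) * (\<integral>\<^sup>+s. ennreal ((norm (fluct t s))\<^sup>2) \<partial>M) + ennreal ?K"
    using K by (simp add: ennreal_mult nn_integral_add nn_integral_cmult M.emeasure_space_1)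
  also have "\<dots> \<le> ennreal (\<theta>\<^sup>2) * ennreal (?K / (1 - \<theta>)) + ennreal ?K"
    using Suc by (intro add_right_mono mult_left_mono) auto
  also have "\<dots> = ennreal (\<theta>\<^sup>2 * (?K / (1 - \<theta>)) + ?K)"
    using K \<theta> by (subst ennreal_plus) (auto simp: ennreal_mult simp del: times_divide_eq_right)
  also have "\<dots> \<le> ennreal (?K / (1 - \<theta>))"
  proof (rule ennreal_leI)
    have "\<theta>\<^sup>2 * (?K / (1 - \<theta>)) \<le> \<theta> * (?K / (1 - \<theta>))"
      using K \<theta> by (intro mult_right_mono) (auto simp: power2_eq_square mult_left_le)
    also have "\<dots> + ?K = ?K / (1 - \<theta>)"
      using \<theta> by (simp add: field_simps)
    finally show "\<theta>\<^sup>2 * (?K / (1 - \<theta>)) + ?K \<le> ?K / (1 - \<theta>)" by simp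
  qed
  finally show ?case .
qed

lemma fluct_first_moment:
  assumes "t \<le> T"
  shows "integrable M (\<lambda>s. norm (fluct t s))"
    and "(\<integral>s. norm (fluct t s) \<partial>M) \<le> sqrt (deviation_bound h \<theta> \<gamma> / (1 - \<theta>))"
proof -
  define k where "k = sqrt (deviation_bound h \<theta> \<gamma> / (1 - \<theta>))"
  have "deviation_bound h \<theta> \<gamma> > 0"
    using L_pos \<gamma>_pos by (simp add: deviation_bound_def add_nonneg_pos)
  then have k: "k > 0" "deviation_bound h \<theta> \<gamma> / (1 - \<theta>) = k\<^sup>2"
    using \<theta> by (auto simp: k_def)
  note mom = fluct_second_moment[OF assms, unfolded k(2)]
  have int: "integrable M (\<lambda>s. (norm (fluct t s))\<^sup>2)"
    using mom by (intro integrableI_bounded) (auto simp: order_le_less_trans[OF _ ennreal_less_top])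
  have mom': "(\<integral>s. (norm (fluct t s))\<^sup>2 \<partial>M) \<le> k\<^sup>2"
    using mom nn_integral_eq_integral[OF int] by (simp add: ennreal_le_iff)
  \<comment> \<open>The weighted inequality of arithmetic and geometric means replaces Jensen: its
    expectation is at most \<open>k\<close> exactly when the second moment is at most
    \<open>k\<^sup>2\<close>.\<close>
  have le: "norm (fluct t s) \<le> ((norm (fluct t s))\<^sup>2 / k + k) / 2" for s
    using sum_squares_bound[of "norm (fluct t s)" k] k(1) by (simp add: field_simps power2_eq_square)
  show int1: "integrable M (\<lambda>s. norm (fluct t s))"
    by (rule Bochner_Integration.integrable_bound[where f = "\<lambda>s. ((norm (fluct t s))\<^sup>2 / k + k) / 2"])
      (use int le k(1) in \<open>auto intro!: AE_I2\<close>)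
  have "(\<integral>s. norm (fluct t s) \<partial>M) \<le> (\<integral>s. ((norm (fluct t s))\<^sup>2 / k + k) / 2 \<partial>M)"
    using int int1 le by (intro integral_mono) auto
  also have "\<dots> = ((\<integral>s. (norm (fluct t s))\<^sup>2 \<partial>M) / k + k) / 2"
    using int by (simp add: M.prob_space)
  also have "\<dots> \<le> k"
    using mom' k(1) by (simp add: field_simps power2_eq_square)
  finally show "(\<integral>s. norm (fluct t s) \<partial>M) \<le> sqrt (deviation_bound h \<theta> \<gamma> / (1 - \<theta>))"
    by (simp add: k_def)
qed

text \<open>This holds on every path: what remains after subtracting \<open>fluct\<close> contracts
  by \<open>\<theta>\<close> and receives only the clipping bias with weight
  \<open>1 - \<theta>\<close>. The initial error is \<open>gf w0\<close> because
  \<open>m 0 = 0\<close>.\<close>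

lemma momentum_error:
  assumes s: "s \<in> space M" and "t \<le> T"
  shows "norm (m t s - gf (w t s)) \<le> \<theta> ^ t * norm (gf w0) + \<sigma> powr p * (h / 2) powr (1 - p) + norm (fluct t s)"
proof -
  let ?\<beta> = "\<sigma> powr p * (h / 2) powr (1 - p)"
  define r where "r t = m t s - gf (w t s) - fluct t s" for t
  have "norm (r t) \<le> \<theta> ^ t * norm (gf w0) + ?\<beta>"
    using assms(2)
  proof (induction t)
    case 0
    show ?case by (simp add: r_def m_0 w_0 s)
  next
    case (Suc t)
    \<comment> \<open>The mean of the correction \<open>g (w (Suc t) s) - g (w t s)\<close> cancels
      the drift of \<open>gf\<close> between the two iterates, and its centred part is in
      \<open>fluct\<close>. Hence no drift term is left.\<close>
    have "r (Suc t) = \<theta> *\<^sub>R r t + (1 - \<theta>) *\<^sub>R (clip_mean h (w (Suc t) s) - gf (w (Suc t) s))"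
      by (simp add: r_def m_Suc[OF s] deviation_def algebra_simps)
    then have "norm (r (Suc t)) \<le> \<theta> * norm (r t) + (1 - \<theta>) * norm (clip_mean h (w (Suc t) s) - gf (w (Suc t) s))"
      using \<theta> by (metis abs_of_nonneg diff_ge_0_iff_ge less_imp_le norm_scaleR norm_triangle_ineq)
    also have "\<dots> \<le> \<theta> * (\<theta> ^ t * norm (gf w0) + ?\<beta>) + (1 - \<theta>) * ?\<beta>"
      using Suc \<theta> clip_bias[OF h_pos gradient_le[OF s Suc.prems]]
      by (intro add_mono mult_left_mono) auto
    also have "\<dots> = \<theta> ^ Suc t * norm (gf w0) + ?\<beta>"
      by (simp add: algebra_simps)
    finally show ?case .
  qed
  then show ?thesis
    using norm_triangle_ineq[of "r t" "fluct t s"] by (simp add: r_def)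
qed

text \<open>The factor 2 arises because the momentum error is paid twice: once for replacing the
  gradient by \<open>m\<close> in the inner product, once for comparing \<open>norm m\<close> with
  the gradient norm.\<close>

lemma descent:
  assumes s: "s \<in> space M"
  shows "\<gamma> * norm (gf (w (Suc t) s)) \<le> f (w (Suc t) s) - f (w (Suc (Suc t)) s)
    + 2 * \<gamma> * norm (m (Suc t) s - gf (w (Suc t) s)) + L * \<gamma>\<^sup>2 / 2"
proof -
  let ?w = "w (Suc t) s" and ?w' = "w (Suc (Suc t)) s" and ?m = "m (Suc t) s"
  have w': "?w' - ?w = - (\<gamma> *\<^sub>R sgn ?m)"
    using w_Suc[OF s] by simp
  have "f ?w' \<le> f ?w + gf ?w \<bullet> (?w' - ?w) + L / 2 * (norm (?w' - ?w))\<^sup>2"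
    by (rule lipschitz_gradient_quadratic_bound[OF gderiv gf_lipschitz])
  moreover have "L / 2 * (norm (?w' - ?w))\<^sup>2 \<le> L / 2 * \<gamma>\<^sup>2"
    using L_pos step_length[OF s, of "Suc t"] by (intro mult_left_mono power_mono) auto
  moreover have "gf ?w \<bullet> (?w' - ?w) \<le> - \<gamma> * norm (gf ?w) + 2 * \<gamma> * norm (?m - gf ?w)"
  proof -
    \<comment> \<open>This also covers a vanishing momentum, where \<open>sgn 0 = 0\<close>.\<close>
    have "?m \<bullet> sgn ?m = norm ?m"
      by (cases "?m = 0") (simp_all add: sgn_div_norm power2_norm_eq_inner[symmetric] power2_eq_square)
    then have "gf ?w \<bullet> (?w' - ?w) = \<gamma> * ((?m - gf ?w) \<bullet> sgn ?m - norm ?m)"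
      unfolding w' by (simp add: inner_diff_left algebra_simps)
    also have "(?m - gf ?w) \<bullet> sgn ?m \<le> norm (?m - gf ?w) * 1"
      by (rule order_trans[OF norm_cauchy_schwarz]) (auto intro!: mult_left_mono simp: norm_sgn)
    finally have 1: "gf ?w \<bullet> (?w' - ?w) \<le> \<gamma> * (norm (?m - gf ?w) - norm ?m)"
      using \<gamma>_pos by simp
    have "norm (gf ?w) \<le> norm ?m + norm (?m - gf ?w)"
      by (metis norm_minus_commute norm_triangle_sub)
    then have "\<gamma> * (norm (?m - gf ?w) - norm ?m) \<le> \<gamma> * (2 * norm (?m - gf ?w) - norm (gf ?w))"
      using \<gamma>_pos by (intro mult_left_mono) auto
    with 1 show ?thesis by (simp add: algebra_simps)
  qed
  ultimately show ?thesis by (simp add: algebra_simps)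
qed

text \<open>The descent inequality is summed on each path before integrating. The function values
  telescope to a deterministic bound, and only gradient norms and fluctuations are
  integrated.\<close>

lemma average_gradient:
  "(1 / T) * (\<Sum>t = 1..T. \<integral>s. norm (gf (w t s)) \<partial>M)
    \<le> (f w0 - f_min) / (\<gamma> * T) + L * \<gamma> / 2 + 2 * norm (gf w0) / (T * (1 - \<theta>))
      + 2 * (\<sigma> powr p * (h / 2) powr (1 - p)) + 2 * sqrt (deviation_bound h \<theta> \<gamma> / (1 - \<theta>))"
proof -
  let ?\<beta> = "\<sigma> powr p * (h / 2) powr (1 - p)" and ?k = "sqrt (deviation_bound h \<theta> \<gamma> / (1 - \<theta>))"
  let ?G = "norm (gf w0)"
  let ?R = "\<Sum>t<T. 2 * (\<theta> ^ Suc t * ?G) + 2 * ?\<beta> + L * \<gamma> / 2"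
  have int: "integrable M (\<lambda>s. norm (gf (w (Suc t) s)))" if "t < T" for t
    using that gradient_le by (intro M.integrable_const_bound[of _ "h / 2"]) auto
  have pt: "(\<Sum>t<T. norm (gf (w (Suc t) s))) \<le> (f w0 - f_min) / \<gamma> + ?R + 2 * (\<Sum>t<T. norm (fluct (Suc t) s))"
    if s: "s \<in> space M" for s
  proof -
    have "norm (gf (w (Suc t) s)) \<le> (f (w (Suc t) s) - f (w (Suc (Suc t)) s)) / \<gamma>
        + (2 * (\<theta> ^ Suc t * ?G) + 2 * ?\<beta> + L * \<gamma> / 2) + 2 * norm (fluct (Suc t) s)" if "t < T" for t
    proof -
      have "norm (gf (w (Suc t) s)) \<le> (f (w (Suc t) s) - f (w (Suc (Suc t)) s)) / \<gamma>
          + 2 * norm (m (Suc t) s - gf (w (Suc t) s)) + L * \<gamma> / 2"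
        using descent[OF s, of t] \<gamma>_pos by (simp add: field_simps power2_eq_square)
      then show ?thesis
        using momentum_error[OF s, of "Suc t"] that by simp
    qed
    then have "(\<Sum>t<T. norm (gf (w (Suc t) s))) \<le> (\<Sum>t<T. (f (w (Suc t) s) - f (w (Suc (Suc t)) s)) / \<gamma>
        + (2 * (\<theta> ^ Suc t * ?G) + 2 * ?\<beta> + L * \<gamma> / 2) + 2 * norm (fluct (Suc t) s))"
      by (intro sum_mono) auto
    also have "\<dots> = (\<Sum>t<T. (f (w (Suc t) s) - f (w (Suc (Suc t)) s)) / \<gamma>) + ?R
        + 2 * (\<Sum>t<T. norm (fluct (Suc t) s))"
      by (simp only: sum.distrib sum_distrib_left)
    \<comment> \<open>The telescope starts at \<open>w 1\<close>, which equals
      \<open>w0\<close>.\<close>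
    also have "(\<Sum>t<T. (f (w (Suc t) s) - f (w (Suc (Suc t)) s)) / \<gamma>) = (f (w 1 s) - f (w (Suc T) s)) / \<gamma>"
      using sum_lessThan_telescope'[of "\<lambda>t. f (w (Suc t) s)" T] by (simp flip: sum_divide_distrib)
    also have "\<dots> \<le> (f w0 - f_min) / \<gamma>"
      using \<gamma>_pos f_min w_1[OF s] by (intro divide_right_mono) auto
    finally show ?thesis by simp
  qed
  have fluct_int: "integrable M (\<lambda>s. norm (fluct (Suc t) s))" if "t < T" for t
    using that by (intro fluct_first_moment(1)) simp
  have sum_int: "integrable M (\<lambda>s. \<Sum>t<T. norm (fluct (Suc t) s))"
    using fluct_int by (intro Bochner_Integration.integrable_sum) (simp del: fluct.simps)
  have sum_le: "(\<integral>s. (\<Sum>t<T. norm (fluct (Suc t) s)) \<partial>M) \<le> (\<Sum>t<T. ?k)"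
  proof -
    have "(\<integral>s. (\<Sum>t<T. norm (fluct (Suc t) s)) \<partial>M) = (\<Sum>t<T. \<integral>s. norm (fluct (Suc t) s) \<partial>M)"
      by (rule Bochner_Integration.integral_sum) (simp add: fluct_int del: fluct.simps)
    also have "\<dots> \<le> (\<Sum>t<T. ?k)"
      by (intro sum_mono fluct_first_moment(2)) simp
    finally show ?thesis .
  qed
  have "(\<Sum>t = 1..T. \<integral>s. norm (gf (w t s)) \<partial>M) = (\<Sum>t<T. \<integral>s. norm (gf (w (Suc t) s)) \<partial>M)"
    by (rule sum.reindex_bij_witness[of _ Suc "\<lambda>t. t - 1"]) auto
  also have "\<dots> = (\<integral>s. (\<Sum>t<T. norm (gf (w (Suc t) s))) \<partial>M)"
    using int by simp
  also have "\<dots> \<le> (\<integral>s. (f w0 - f_min) / \<gamma> + ?R + 2 * (\<Sum>t<T. norm (fluct (Suc t) s)) \<partial>M)"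
  proof (rule integral_mono[OF _ _ pt])
    show "integrable M (\<lambda>s. \<Sum>t<T. norm (gf (w (Suc t) s)))"
      using int by (intro Bochner_Integration.integrable_sum) simp
    show "integrable M (\<lambda>s. (f w0 - f_min) / \<gamma> + ?R + 2 * (\<Sum>t<T. norm (fluct (Suc t) s)))"
      by (intro Bochner_Integration.integrable_add integrable_mult_right sum_int M.integrable_const)
  qed
  also have "\<dots> = (f w0 - f_min) / \<gamma> + ?R + 2 * (\<integral>s. (\<Sum>t<T. norm (fluct (Suc t) s)) \<partial>M)"
    using sum_int by (simp add: M.prob_space del: fluct.simps integral_sum)
  also have "\<dots> \<le> (f w0 - f_min) / \<gamma> + ?R + 2 * (\<Sum>t<T. ?k)"
    using sum_le by (intro add_left_mono mult_left_mono) simp_all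
  also have "?R = 2 * ?G * (\<Sum>t<T. \<theta> ^ Suc t) + T * (2 * ?\<beta> + L * \<gamma> / 2)"
    by (simp add: sum.distrib sum_distrib_left algebra_simps)
  also have "(\<Sum>t<T. \<theta> ^ Suc t) \<le> 1 / (1 - \<theta>)"
  proof -
    have "(\<Sum>t<T. \<theta> ^ Suc t) \<le> (\<Sum>t<T. \<theta> ^ t)"
      using \<theta> by (intro sum_mono) (simp add: mult_left_le_one_le)
    also have "\<dots> = (1 - \<theta> ^ T) / (1 - \<theta>)"
      using \<theta> by (simp add: sum_gp_strict)
    also have "\<dots> \<le> 1 / (1 - \<theta>)"
      using \<theta> by (intro divide_right_mono) auto
    finally show ?thesis .
  qed
  finally have "(\<Sum>t = 1..T. \<integral>s. norm (gf (w t s)) \<partial>M)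
      \<le> (f w0 - f_min) / \<gamma> + (2 * ?G * (1 / (1 - \<theta>)) + T * (2 * ?\<beta> + L * \<gamma> / 2)) + 2 * (T * ?k)"
    by (simp add: mult_left_mono)
  then have "(1 / T) * (\<Sum>t = 1..T. \<integral>s. norm (gf (w t s)) \<partial>M) \<le> (1 / T) *
      ((f w0 - f_min) / \<gamma> + (2 * ?G * (1 / (1 - \<theta>)) + T * (2 * ?\<beta> + L * \<gamma> / 2)) + 2 * (T * ?k))"
    by (intro mult_left_mono) auto
  also have "\<dots> = (f w0 - f_min) / (\<gamma> * T) + L * \<gamma> / 2 + 2 * ?G / (T * (1 - \<theta>)) + 2 * ?\<beta> + 2 * ?k"
    using T \<theta> \<gamma>_pos by (simp add: field_simps)
  finally show ?thesis .
qed

end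

subsection \<open>The rate for the prescribed parameters\<close>

text \<open>Put \<open>\<sigma> = exp ((2p - 1) z)\<close> and \<open>T = exp ((2p - 1) s)\<close>, which clears all denominators in the
  exponents. Then \<open>ly\<close> is the logarithm of the fourth root of \<open>1 - \<theta>\<close>, and \<open>lA\<close> is that of the
  part of \<open>h / 2\<close> that does not involve the initial gradient.\<close>
lemma exponent_bounds:
  fixes p z s :: real
  defines "ly \<equiv> - max 0 (max (p * z) ((2 * p - 2) * z) + p * s) / 4"
  defines "lA \<equiv> ly + (p + 4) / 4 * s + max 0 (9 * p * z / 4)"
  assumes p: "1 < p" "p \<le> 2" and s: "0 \<le> s"
  shows "p * (2 * p - 1) * z + (1 - p) * lA \<le> p * z - (p - 1) * s"
    and "2 * ly + p * (2 * p - 1) / 2 * z + (2 - p) / 2 * lA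
      \<le> max (max (p * z - (p - 1) * s) (p * (2 * p - 1) / 16 * z - (p - 1) * s)) (- (2 * p - 1) / 2 * s)"
    and "2 * ly + p * (2 * p - 1) / 2 * z
      \<le> max (max ((p\<^sup>2 - p) * z - p / 2 * s) ((2 * p\<^sup>2 - 5 * p + 2) / 2 * z - p / 2 * s)) (- (2 * p - 1) / 2 * s)"
proof -
  \<comment> \<open>\<open>large\<close> means \<open>\<sigma> \<ge> 1\<close>, \<open>tiny\<close>
    means \<open>\<theta> = 0\<close>, and \<open>small\<close> is the range between. Which power of
    \<open>\<sigma>\<close> attains the maximum in \<open>1 - \<theta>\<close> depends on the sign
    of \<open>z\<close>, as \<open>2 * p - 2 \<le> p\<close>. In \<open>large\<close> each left side
    equals a term on the right.\<close>
  consider (large) "z \<ge> 0" | (small) "z < 0" "(2 * p - 2) * z + p * s \<ge> 0"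
    | (tiny) "z < 0" "(2 * p - 2) * z + p * s < 0"
    by linarith
  then have "p * (2 * p - 1) * z + (1 - p) * lA \<le> p * z - (p - 1) * s
    \<and> 2 * ly + p * (2 * p - 1) / 2 * z + (2 - p) / 2 * lA
      \<le> max (max (p * z - (p - 1) * s) (p * (2 * p - 1) / 16 * z - (p - 1) * s)) (- (2 * p - 1) / 2 * s)
    \<and> 2 * ly + p * (2 * p - 1) / 2 * z
      \<le> max (max ((p\<^sup>2 - p) * z - p / 2 * s) ((2 * p\<^sup>2 - 5 * p + 2) / 2 * z - p / 2 * s)) (- (2 * p - 1) / 2 * s)"
  proof cases
    case large
    have "(2 * p - 2) * z \<le> p * z" using large p by (intro mult_right_mono) auto
    moreover have "0 \<le> p * z" "0 \<le> p * s" using large p s by auto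
    ultimately have ly: "ly = - (p * z + p * s) / 4" and lA: "lA = 2 * p * z + s"
      by (auto simp: lA_def ly_def max_def field_simps)
    have "p * (2 * p - 1) * z + (1 - p) * lA = p * z - (p - 1) * s"
      "2 * ly + p * (2 * p - 1) / 2 * z + (2 - p) / 2 * lA = p * z - (p - 1) * s"
      "2 * ly + p * (2 * p - 1) / 2 * z = (p\<^sup>2 - p) * z - p / 2 * s"
      unfolding lA ly by (simp_all add: field_simps power2_eq_square)
    then show ?thesis by (simp only: le_max_iff_disj) simp
  next
    case small
    have "p * z \<le> (2 * p - 2) * z" using small p by (intro mult_right_mono_neg) auto
    moreover have "p * z < 0" using small p by (intro mult_pos_neg) auto
    ultimately have ly: "ly = - ((2 * p - 2) * z + p * s) / 4" and lA: "lA = s - (p - 1) / 2 * z"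
      using small(2) by (auto simp: lA_def ly_def max_def field_simps)
    have neg: "c * z \<le> 0" if "c \<ge> 0" for c
      using that small(1) by (intro mult_nonneg_nonpos) auto
    have 1: "p * (2 * p - 1) * z + (1 - p) * lA = p * z - (p - 1) * s + (p * (2 * p - 2) + (p - 1)\<^sup>2 / 2) * z"
      unfolding lA by (simp add: field_simps power2_eq_square)
    have 2: "2 * ly + p * (2 * p - 1) / 2 * z + (2 - p) / 2 * lA
        = p * (2 * p - 1) / 16 * z - (p - 1) * s + (18 * p\<^sup>2 - 35 * p + 24) / 16 * z"
      unfolding lA ly by (simp add: field_simps power2_eq_square)
    have 3: "2 * ly + p * (2 * p - 1) / 2 * z = (2 * p\<^sup>2 - 5 * p + 2) / 2 * z - p / 2 * s + p * z"
      unfolding ly by (simp add: field_simps power2_eq_square)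
    \<comment> \<open>Completing the square shows that the leftover coefficient is positive; it
      multiplies a negative \<open>z\<close>.\<close>
    have "18 * p\<^sup>2 - 35 * p + 24 = 18 * (p - 35 / 36)\<^sup>2 + 503 / 72"
      by (simp add: field_simps power2_eq_square)
    then have "(18 * p\<^sup>2 - 35 * p + 24) / 16 * z \<le> 0"
      by (intro neg) simp
    then have "2 * ly + p * (2 * p - 1) / 2 * z + (2 - p) / 2 * lA \<le> p * (2 * p - 1) / 16 * z - (p - 1) * s"
      unfolding 2 by simp
    moreover have "(p * (2 * p - 2) + (p - 1)\<^sup>2 / 2) * z \<le> 0" "p * z \<le> 0"
      using p by (intro neg; simp)+
    then have "p * (2 * p - 1) * z + (1 - p) * lA \<le> p * z - (p - 1) * s"
      "2 * ly + p * (2 * p - 1) / 2 * z \<le> (2 * p\<^sup>2 - 5 * p + 2) / 2 * z - p / 2 * s"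
      unfolding 1 3 by simp_all
    ultimately show ?thesis
      by (simp only: le_max_iff_disj) simp
  next
    case tiny
    have "p * z \<le> (2 * p - 2) * z" using tiny p by (intro mult_right_mono_neg) auto
    moreover have pz: "p * z < 0" using tiny p by (intro mult_pos_neg) auto
    ultimately have ly: "ly = 0" and lA: "lA = (p + 4) / 4 * s"
      using tiny(2) by (auto simp: lA_def ly_def max_def field_simps)
    \<comment> \<open>When \<open>\<theta> = 0\<close>, \<open>\<sigma>\<close> is below a negative
      power of \<open>T\<close>. Trading \<open>\<sigma>\<close> for \<open>T\<close> brings the
      second and third quantities under the \<open>T\<close> to the power \<open>-1/2\<close>
      term.\<close>
    have z: "z \<le> - (p * s / (2 * p - 2))"
      using tiny(2) p by (simp add: field_simps)
    have "(2 * p - 2) * (p * z) \<le> 0"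
      by (rule mult_nonneg_nonpos) (use p pz in linarith)+
    moreover have "0 \<le> (p - 1) * p * s" using p s by simp
    ultimately have 1: "p * (2 * p - 1) * z + (1 - p) * lA \<le> p * z - (p - 1) * s"
      unfolding lA by (simp add: field_simps)
    have 2: "p * (2 * p - 1) / 2 * z + (2 - p) / 2 * lA \<le> - (2 * p - 1) / 2 * s"
    proof -
      have "(p * (2 * p - 1) / 2) * z \<le> (p * (2 * p - 1) / 2) * - (p * s / (2 * p - 2))"
        using p z by (intro mult_left_mono) auto
      \<comment> \<open>Clearing denominators in the inequality below leaves this polynomial in
        \<open>p - 1\<close>, which is nonnegative since \<open>0 < p - 1 \<le> 1\<close>.\<close>
      moreover have "0 \<le> (5 * (p - 1)^3 + 6 * (p - 1)\<^sup>2 - (p - 1) + 2) * s"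
      proof -
        have "0 \<le> (p - 1)^3" "0 \<le> (p - 1)\<^sup>2" using p by auto
        then have "0 \<le> 5 * (p - 1)^3 + 6 * (p - 1)\<^sup>2 - (p - 1) + 2" using p by linarith
        with s show ?thesis by simp
      qed
      then have "(p * (2 * p - 1) / 2) * - (p * s / (2 * p - 2)) + (2 - p) / 2 * ((p + 4) / 4 * s)
          \<le> - (2 * p - 1) / 2 * s"
        using p by (simp add: field_simps power2_eq_square power3_eq_cube)
      ultimately show ?thesis
        unfolding lA by linarith
    qed
    have "p * z \<le> p * - (p * s / (2 * p - 2))"
      using p z by (intro mult_left_mono) auto
    also have "\<dots> \<le> - s"
    proof -
      have "0 \<le> (1 + (p - 1)\<^sup>2) * s" using s by simp
      then show ?thesis using p by (simp add: field_simps power2_eq_square)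
    qed
    finally have "(2 * p - 1) / 2 * (p * z) \<le> (2 * p - 1) / 2 * - s"
      using p by (intro mult_left_mono) auto
    then have "p * (2 * p - 1) / 2 * z \<le> - (2 * p - 1) / 2 * s"
      by (simp add: algebra_simps)
    then show ?thesis using 1 2 unfolding ly le_max_iff_disj by simp
  qed
  then show "p * (2 * p - 1) * z + (1 - p) * lA \<le> p * z - (p - 1) * s"
    and "2 * ly + p * (2 * p - 1) / 2 * z + (2 - p) / 2 * lA
      \<le> max (max (p * z - (p - 1) * s) (p * (2 * p - 1) / 16 * z - (p - 1) * s)) (- (2 * p - 1) / 2 * s)"
    and "2 * ly + p * (2 * p - 1) / 2 * z
      \<le> max (max ((p\<^sup>2 - p) * z - p / 2 * s) ((2 * p\<^sup>2 - 5 * p + 2) / 2 * z - p / 2 * s)) (- (2 * p - 1) / 2 * s)"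
    by auto
qed

section \<open>Comparison of monomials through their exponents\<close>

lemma exp_max_le: "exp (max a b) \<le> exp a + exp (b :: real)"
  by (simp add: max_def)

text \<open>Subadditivity of concave powers: in \<open>c powr r = c * c powr (r - 1)\<close> the
  second factor decreases in \<open>c\<close>.\<close>

lemma powr_add_le_rpow:
  fixes a b r :: real
  assumes "a > 0" "b \<ge> 0" "0 \<le> r" "r \<le> 1"
  shows "(a + b) powr r \<le> a powr r + rpow b r"
proof (cases "b = 0")
  case False
  with assms have b: "b > 0" by simp
  have eq: "c powr r = c * c powr (r - 1)" if "c > 0" for c
    using that powr_add[of c 1 "r - 1"] by simp
  have "(a + b) powr r = a * (a + b) powr (r - 1) + b * (a + b) powr (r - 1)"
    using eq[of "a + b"] assms b by (simp add: algebra_simps)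
  also have "\<dots> \<le> a * a powr (r - 1) + b * b powr (r - 1)"
    using assms b by (intro add_mono mult_left_mono powr_mono2') auto
  also have "\<dots> \<le> a powr r + rpow b r"
    using eq[of a] eq[of b] assms b by (auto simp: rpow_def)
  finally show ?thesis .
qed (use assms in \<open>auto simp: rpow_def\<close>)

text \<open>Measured in units of \<open>ln u / (2 * p - 1)\<close>, all exponents become polynomial
  in \<open>p\<close>, so that comparing monomials reduces to inequalities linear in these
  logarithms.\<close>

lemma powr_eq_exp_scaled:
  fixes u p k :: real
  assumes "u > 0" "p > 1"
  shows "u powr (k / (2 * p - 1)) = exp (k * (ln u / (2 * p - 1)))"
    and "u powr (k / (4 * p - 2)) = exp (k / 2 * (ln u / (2 * p - 1)))"
    and "u powr (k / (8 * p - 4)) = exp (k / 4 * (ln u / (2 * p - 1)))"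
    and "u powr k = exp (k * (2 * p - 1) * (ln u / (2 * p - 1)))"
proof -
  have "4 * p - 2 = 2 * (2 * p - 1)" "8 * p - 4 = 4 * (2 * p - 1)" "2 * p - 1 \<noteq> 0"
    using assms by auto
  then show "u powr (k / (2 * p - 1)) = exp (k * (ln u / (2 * p - 1)))"
    and "u powr (k / (4 * p - 2)) = exp (k / 2 * (ln u / (2 * p - 1)))"
    and "u powr (k / (8 * p - 4)) = exp (k / 4 * (ln u / (2 * p - 1)))"
    and "u powr k = exp (k * (2 * p - 1) * (ln u / (2 * p - 1)))"
    using assms(1) by (simp_all add: powr_def)
qed

lemma max_exp: "max (exp a) (exp b) = exp (max a b :: real)"
  by (simp add: max_def)

lemma root_exp: "n > 0 \<Longrightarrow> root n (exp a) = exp (a / n)"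
  by (rule real_root_pos_unique) (simp_all flip: exp_of_nat_mult)

text \<open>The left side is the bound on the average gradient norm with
  \<open>x = 1 - \<theta>\<close>, \<open>y / sqrt t = L * \<gamma>\<close> and
  \<open>H = h / 2\<close>; \<open>\<Delta>\<close> is \<open>L\<close> times the initial gap and
  \<open>G\<close> the initial gradient norm.\<close>

lemma rate_estimate:
  fixes \<sigma> p t G \<Delta> :: real
  defines "x \<equiv> min (1 / (max (\<sigma> powr (p / (2*p - 1))) (\<sigma> powr ((2*p - 2) / (2*p - 1)))
      * t powr (p / (2*p - 1)))) 1"
  defines "y \<equiv> root 4 x"
  defines "H \<equiv> y / sqrt t * t powr ((5*p + 2) / (8*p - 4)) * max 1 (\<sigma> powr (9*p / (8*p - 4))) + G"
  assumes \<sigma>: "\<sigma> > 0" and p: "1 < p" "p \<le> 2" and t: "t \<ge> 1" and G: "G \<ge> 0" and \<Delta>: "\<Delta> \<ge> 0"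
  shows "\<Delta> / (y * sqrt t) + y / sqrt t / 2 + 2 * G / (t * x) + 2 * (\<sigma> powr p * H powr (1 - p))
      + 2 * sqrt ((2 * x\<^sup>2 * (\<sigma> powr p * (3 * H) powr (2 - p)) + 2 * (y / sqrt t)\<^sup>2) / x)
    \<le> (20 * \<sigma> powr (p / (2*p - 1))
          + 2 * G * (\<sigma> powr (p / (2*p - 1)) + \<sigma> powr ((2*p - 2) / (2*p - 1)))
          + 16 * \<sigma> powr (p / 16)) / t powr ((p - 1) / (2*p - 1))
      + (\<Delta> + 5) * (\<sigma> powr ((p - 1) / (4*p - 2)) + \<sigma> powr (p / (8*p - 4))) / t powr ((3*p - 2) / (8*p - 4))
      + 16 * rpow G ((2 - p) / 2)
          * (\<sigma> powr ((p^2 - p) / (2*p - 1)) + \<sigma> powr ((2*p^2 - 5*p + 2) / (4*p - 2)))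
          / t powr (p / (4*p - 2))
      + 16 * \<sigma> powr ((5*p^2 - 9*p + 6) / (8*p - 4)) / t powr ((5*p - 1) / (8*p - 4))
      + (\<Delta> + 16 * rpow G ((2 - p) / 2) + 9) / t powr (1 / 2)
      + 2 * G / t"
proof -
  define z s r where "z = ln \<sigma> / (2*p - 1)" and "s = ln t / (2*p - 1)" and "r = (2 - p) / 2"
  have s: "s \<ge> 0" using t p by (simp add: s_def)
  have t_pos: "t > 0" using t by simp
  note \<sigma>_exp = powr_eq_exp_scaled[OF \<sigma> p(1), folded z_def]
  note t_exp = powr_eq_exp_scaled[OF t_pos p(1), folded s_def]
  have sqrt_t: "sqrt t = exp ((2*p - 1) / 2 * s)"
    using t_exp(4)[of "1 / 2"] t_pos by (simp add: powr_half_sqrt)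
  have t_eq: "t = exp ((2*p - 1) * s)"
    using t_exp(4)[of 1] t_pos by simp
  define e where "e = max 0 (max (p * z) ((2*p - 2) * z) + p * s)"
  define ly where "ly = - e / 4"
  define lA where "lA = ly + (p + 4) / 4 * s + max 0 (9 * p * z / 4)"
  have x: "x = exp (- e)"
    unfolding x_def \<sigma>_exp(1) t_exp(1) max_exp e_def
    by (simp add: exp_minus inverse_eq_divide min_def max_def flip: exp_add)
  have y: "y = exp ly"
    unfolding y_def x ly_def by (simp add: root_exp)
  have y2: "y\<^sup>2 * y\<^sup>2 = x"
    unfolding x y ly_def by (simp flip: exp_of_nat_mult exp_add)
  define A where "A = exp lA"
  have "y / sqrt t * t powr ((5*p + 2) / (8*p - 4)) * max 1 (\<sigma> powr (9*p / (8*p - 4))) = A"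
  proof -
    have "max 1 (\<sigma> powr (9*p / (8*p - 4))) = exp (max 0 (9 * p * z / 4))"
      unfolding \<sigma>_exp(3) using max_exp[of 0] by simp
    then show ?thesis
      unfolding y sqrt_t t_exp(3) A_def lA_def
      by (simp add: field_simps flip: exp_add exp_diff)
  qed
  then have H: "H = A + G" by (simp add: H_def)
  have A: "A > 0" by (simp add: A_def)
  note ebs = exponent_bounds[OF p s, of z, folded e_def, folded ly_def, folded lA_def]
  \<comment> \<open>\<open>N1\<close> is the clipping bias. The clipped noise contributes
    \<open>N3 * H powr r\<close> up to a constant, and splitting \<open>H = A + G\<close> turns this
    into \<open>N2\<close> and \<open>g * N3\<close>.\<close>
  define N1 N2 N3 g where "N1 = \<sigma> powr p * H powr (1 - p)" and "N2 = y\<^sup>2 * \<sigma> powr (p / 2) * A powr r"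
    and "N3 = y\<^sup>2 * \<sigma> powr (p / 2)" and "g = rpow G r"
  have g: "g \<ge> 0" by (simp add: g_def rpow_def)
  have N3_eq: "N3 = exp (2 * ly + p * (2*p - 1) / 2 * z)"
    unfolding N3_def y \<sigma>_exp(4) by (simp add: exp_add flip: exp_of_nat_mult)
  have N2_eq: "N2 = exp (2 * ly + p * (2*p - 1) / 2 * z + (2 - p) / 2 * lA)"
    using N3_eq by (simp add: N2_def N3_def A_def r_def exp_add powr_def)

  \<comment> \<open>The exponent is a maximum of three linear functions, so the quantity is the
    largest of three monomials and at most their sum. \<open>B3\<close>, \<open>B5\<close> and
    \<open>B6\<close> rest on the same passage.\<close>
  have B1: "1 / (y * sqrt t) \<le> (\<sigma> powr ((p - 1) / (4*p - 2)) + \<sigma> powr (p / (8*p - 4))) / t powr ((3*p - 2) / (8*p - 4))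
      + 1 / t powr (1 / 2)"
  proof -
    have "1 / (y * sqrt t) = exp (- (ly + (2*p - 1) / 2 * s))"
      unfolding y sqrt_t exp_minus exp_add by (simp add: inverse_eq_divide)
    also have "- (ly + (2*p - 1) / 2 * s) = max (max ((p - 1) / 2 * z - (3*p - 2) / 4 * s)
        (p / 4 * z - (3*p - 2) / 4 * s)) (- ((2*p - 1) / 2 * s))"
      unfolding ly_def e_def by (simp add: max_def field_simps)
    also have "exp \<dots> \<le> exp ((p - 1) / 2 * z - (3*p - 2) / 4 * s) + exp (p / 4 * z - (3*p - 2) / 4 * s)
        + exp (- ((2*p - 1) / 2 * s))"
      by (intro order_trans[OF exp_max_le] add_mono exp_max_le order_refl)
    finally show ?thesis
      unfolding \<sigma>_exp(2,3) t_exp(3) t_exp(4)[of "1 / 2"]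
      by (simp add: exp_diff exp_minus inverse_eq_divide add_divide_distrib)
  qed
  have B2: "y / sqrt t \<le> 1 / t powr (1 / 2)"
    using t_pos by (simp add: powr_half_sqrt divide_right_mono y ly_def e_def)
  have B3: "1 / (t * x) \<le> (\<sigma> powr (p / (2*p - 1)) + \<sigma> powr ((2*p - 2) / (2*p - 1))) / t powr ((p - 1) / (2*p - 1))
      + 1 / t"
  proof -
    have "1 / (t * x) = exp (- ((2*p - 1) * s + - e))"
      unfolding x t_eq exp_minus[of "_ + _"] exp_add by (simp add: inverse_eq_divide)
    also have "- ((2*p - 1) * s + - e) = max (max (p * z - (p - 1) * s) ((2*p - 2) * z - (p - 1) * s)) (- ((2*p - 1) * s))"
      unfolding e_def by (simp add: max_def field_simps)
    also have "exp \<dots> \<le> exp (p * z - (p - 1) * s) + exp ((2*p - 2) * z - (p - 1) * s) + exp (- ((2*p - 1) * s))"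
      by (intro order_trans[OF exp_max_le] add_mono exp_max_le order_refl)
    also have "exp (- ((2*p - 1) * s)) = 1 / t"
      by (simp only: t_eq exp_minus inverse_eq_divide)
    finally show ?thesis
      unfolding \<sigma>_exp(1) t_exp(1) by (simp add: exp_diff add_divide_distrib)
  qed
  have B4: "N1 \<le> \<sigma> powr (p / (2*p - 1)) / t powr ((p - 1) / (2*p - 1))"
  proof -
    have "N1 \<le> \<sigma> powr p * A powr (1 - p)"
      unfolding N1_def H using A G p by (intro mult_left_mono powr_mono2') auto
    also have "\<dots> = exp (p * (2 * p - 1) * z + (1 - p) * lA)"
      unfolding \<sigma>_exp(4) by (simp add: A_def powr_def exp_add)
    also have "\<dots> \<le> exp (p * z - (p - 1) * s)"
      using ebs(1) by simp
    finally show ?thesis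
      unfolding \<sigma>_exp(1) t_exp(1) by (simp add: exp_diff)
  qed
  have "- (2 * p - 1) / 2 * s = - (1 / 2 * (2 * p - 1) * s)" by (simp add: field_simps)
  then have Z_exp: "exp (- (2 * p - 1) / 2 * s) = 1 / t powr (1 / 2)"
    by (simp only: t_exp(4) exp_minus inverse_eq_divide)
  have B5: "N2 \<le> (\<sigma> powr (p / (2*p - 1)) + \<sigma> powr (p / 16)) / t powr ((p - 1) / (2*p - 1)) + 1 / t powr (1 / 2)"
  proof -
    have "N2 \<le> exp (max (max (p * z - (p - 1) * s) (p * (2 * p - 1) / 16 * z - (p - 1) * s)) (- (2 * p - 1) / 2 * s))"
      unfolding N2_eq using ebs(2) by (simp only: exp_le_cancel_iff)
    also have "\<dots> \<le> exp (p * z - (p - 1) * s) + exp (p * (2 * p - 1) / 16 * z - (p - 1) * s) + exp (- (2 * p - 1) / 2 * s)"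
      by (intro order_trans[OF exp_max_le] add_mono exp_max_le order_refl)
    also note Z_exp
    finally show ?thesis
      unfolding \<sigma>_exp(1) \<sigma>_exp(4)[of "p / 16"] t_exp(1) by (simp add: exp_diff add_divide_distrib)
  qed
  have B6: "N3 \<le> (\<sigma> powr ((p^2 - p) / (2*p - 1)) + \<sigma> powr ((2*p^2 - 5*p + 2) / (4*p - 2))) / t powr (p / (4*p - 2))
      + 1 / t powr (1 / 2)"
  proof -
    have "N3 \<le> exp (max (max ((p\<^sup>2 - p) * z - p / 2 * s) ((2 * p\<^sup>2 - 5 * p + 2) / 2 * z - p / 2 * s)) (- (2 * p - 1) / 2 * s))"
      unfolding N3_eq using ebs(3) by (simp only: exp_le_cancel_iff)
    also have "\<dots> \<le> exp ((p\<^sup>2 - p) * z - p / 2 * s) + exp ((2 * p\<^sup>2 - 5 * p + 2) / 2 * z - p / 2 * s) + exp (- (2 * p - 1) / 2 * s)"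
      by (intro order_trans[OF exp_max_le] add_mono exp_max_le order_refl)
    also note Z_exp
    finally show ?thesis
      unfolding \<sigma>_exp(1,2) t_exp(2) by (simp add: exp_diff add_divide_distrib)
  qed

  have B7: "2 * sqrt ((2 * x\<^sup>2 * (\<sigma> powr p * (3 * H) powr (2 - p)) + 2 * (y / sqrt t)\<^sup>2) / x)
      \<le> 5.4 * N2 + 5.4 * (g * N3) + 3 * (1 / (y * sqrt t))"
  proof -
    \<comment> \<open>Because \<open>y\<^sup>2\<close> is the square root of \<open>x\<close>, the
      radicand is \<open>2 * (a\<^sup>2 + b\<^sup>2)\<close>. The constant 3 absorbs twice the
      square root of 2.\<close>
    define a b where "a = N3 * (3 * H) powr r" and "b = 1 / (y * sqrt t)"
    have H_pos: "H > 0" using A G by (simp add: H)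
    have y_pos: "y > 0" by (simp add: y)
    have ab: "a \<ge> 0" "b \<ge> 0"
      using y_pos t_pos by (simp_all add: a_def b_def N3_def)
    have "\<sigma> powr p = (\<sigma> powr (p / 2))\<^sup>2" "(3 * H) powr (2 - p) = ((3 * H) powr r)\<^sup>2"
      using \<sigma> H_pos by (simp_all add: r_def power2_eq_square flip: powr_add)
    then have "(2 * x\<^sup>2 * (\<sigma> powr p * (3 * H) powr (2 - p)) + 2 * (y / sqrt t)\<^sup>2) / x = 2 * (a\<^sup>2 + b\<^sup>2)"
      using y_pos t_pos unfolding a_def b_def N3_def y2[symmetric]
      by (simp add: field_simps power2_eq_square)
    also have "2 * sqrt (2 * (a\<^sup>2 + b\<^sup>2)) \<le> 3 * (a + b)"
    proof -
      have "8 * (a\<^sup>2 + b\<^sup>2) \<le> (3 * (a + b))\<^sup>2"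
        using ab by (simp add: power2_eq_square algebra_simps)
      then have "sqrt (2\<^sup>2 * (2 * (a\<^sup>2 + b\<^sup>2))) \<le> 3 * (a + b)"
        using ab by (intro real_le_lsqrt) auto
      then show ?thesis by (simp only: real_sqrt_mult real_sqrt_abs)
    qed
    finally have "2 * sqrt ((2 * x\<^sup>2 * (\<sigma> powr p * (3 * H) powr (2 - p)) + 2 * (y / sqrt t)\<^sup>2) / x) \<le> 3 * (a + b)"
      by simp
    moreover have "a \<le> 1.8 * (N2 + g * N3)"
    proof -
      \<comment> \<open>As \<open>r \<le> 1 / 2\<close>, the factor is at most the square root of 3,
        hence at most 1.8; the coefficient 5.4 is \<open>3 * 1.8\<close>.\<close>
      have "(3 :: real) powr r \<le> 3 powr (1 / 2)"
        using p by (intro powr_mono) (auto simp: r_def)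
      also have "\<dots> \<le> 1.8"
        using real_le_lsqrt[of "9 / 5" 3] by (simp add: powr_half_sqrt power2_eq_square)
      finally have "3 powr r * H powr r \<le> 1.8 * (A powr r + g)"
        unfolding H g_def using A G p
        by (intro mult_mono powr_add_le_rpow) (auto simp: r_def)
      then have "N3 * (3 powr r * H powr r) \<le> N3 * (1.8 * (A powr r + g))"
        by (intro mult_left_mono) (auto simp: N3_def)
      then show ?thesis
        using H_pos by (simp add: a_def powr_mult N2_def N3_def algebra_simps)
    qed
    ultimately show ?thesis by (simp add: b_def)
  qed

  define P where "P = (\<sigma> powr ((p - 1) / (4*p - 2)) + \<sigma> powr (p / (8*p - 4))) / t powr ((3*p - 2) / (8*p - 4))"
  define Q where "Q = (\<sigma> powr ((p^2 - p) / (2*p - 1)) + \<sigma> powr ((2*p^2 - 5*p + 2) / (4*p - 2))) / t powr (p / (4*p - 2))"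
  define R where "R = (\<sigma> powr (p / (2*p - 1)) + \<sigma> powr ((2*p - 2) / (2*p - 1))) / t powr ((p - 1) / (2*p - 1))"
  define U where "U = \<sigma> powr (p / (2*p - 1)) / t powr ((p - 1) / (2*p - 1))"
  define V where "V = \<sigma> powr (p / 16) / t powr ((p - 1) / (2*p - 1))"
  define W where "W = 16 * \<sigma> powr ((5*p^2 - 9*p + 6) / (8*p - 4)) / t powr ((5*p - 1) / (8*p - 4))"
  define Z where "Z = 1 / t powr (1 / 2)"
  have nonneg: "P \<ge> 0" "Q \<ge> 0" "R \<ge> 0" "U \<ge> 0" "V \<ge> 0" "W \<ge> 0" "Z \<ge> 0"
    by (simp_all add: P_def Q_def R_def U_def V_def W_def Z_def)
  define K b c d where "K = 2 * sqrt ((2 * x\<^sup>2 * (\<sigma> powr p * (3 * H) powr (2 - p)) + 2 * (y / sqrt t)\<^sup>2) / x)"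
    and "b = 1 / (y * sqrt t)" and "c = y / sqrt t" and "d = 1 / (t * x)"
  have K: "K \<le> 5.4 * N2 + 5.4 * (g * N3) + 3 * b"
    using B7 by (simp only: K_def b_def)
  have B: "b \<le> P + Z" "c \<le> Z" "d \<le> R + 1 / t" "N1 \<le> U" "N3 \<le> Q + Z"
    unfolding b_def c_def d_def P_def Q_def R_def U_def Z_def
    by (rule B1 B2 B3 B4 B6)+
  have "N2 \<le> U + V + Z"
    using B5 by (simp only: U_def V_def Z_def add_divide_distrib)
  moreover have "\<Delta> * b \<le> \<Delta> * P + \<Delta> * Z" "G * d \<le> G * R + G * (1 / t)" "g * N3 \<le> g * Q + g * Z"
    unfolding distrib_left[symmetric] by (intro mult_left_mono B \<Delta> G g)+
  moreover have "g * Q \<ge> 0" "g * Z \<ge> 0"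
    using g nonneg by simp_all
  \<comment> \<open>Counting coefficients: \<open>U\<close> receives 2 + 5.4, \<open>V\<close> and
    \<open>g * Q\<close> receive 5.4, \<open>P\<close> receives 3 besides \<open>\<Delta>\<close>,
    and the pure \<open>Z\<close> terms add up to 0.5 + 5.4 + 3 = 8.9.\<close>
  ultimately have "\<Delta> * b + c / 2 + 2 * (G * d) + 2 * N1 + K
    \<le> 20 * U + 2 * (G * R) + 16 * V + (\<Delta> * P + 5 * P) + 16 * (g * Q) + W + (\<Delta> * Z + 16 * (g * Z) + 9 * Z)
      + 2 * (G * (1 / t))"
    using K B nonneg by argo
  moreover have "20 * U + 2 * (G * R) + 16 * V
      = (20 * \<sigma> powr (p / (2*p - 1))
          + 2 * G * (\<sigma> powr (p / (2*p - 1)) + \<sigma> powr ((2*p - 2) / (2*p - 1)))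
          + 16 * \<sigma> powr (p / 16)) / t powr ((p - 1) / (2*p - 1))"
    unfolding U_def R_def V_def by (simp only: add_divide_distrib distrib_left times_divide_eq_right mult.assoc)
  moreover have "\<Delta> * P + 5 * P = (\<Delta> + 5) * (\<sigma> powr ((p - 1) / (4*p - 2)) + \<sigma> powr (p / (8*p - 4)))
      / t powr ((3*p - 2) / (8*p - 4))"
    unfolding P_def distrib_right[symmetric] by (rule times_divide_eq_right)
  moreover have "16 * (g * Q) = 16 * g * (\<sigma> powr ((p^2 - p) / (2*p - 1)) + \<sigma> powr ((2*p^2 - 5*p + 2) / (4*p - 2)))
      / t powr (p / (4*p - 2))"
    by (simp only: Q_def times_divide_eq_right mult.assoc)
  moreover have "\<Delta> * Z + 16 * (g * Z) + 9 * Z = (\<Delta> + 16 * g + 9) / t powr (1 / 2)"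
    by (simp only: Z_def times_divide_eq_right mult_1_right add_divide_distrib)
  moreover have "\<Delta> * b = \<Delta> / (y * sqrt t)" "2 * (G * d) = 2 * G / (t * x)" "2 * (G * (1 / t)) = 2 * G / t"
    by (simp_all add: b_def d_def)
  ultimately show ?thesis
    unfolding W_def K_def c_def N1_def g_def r_def by (simp only:)
qed

section \<open>Instantiation with the prescribed parameters\<close>

theorem theorem4:
  fixes D :: "'x measure" and M :: "'s measure"
    and F :: "real ^ 'd \<Rightarrow> 'x \<Rightarrow> real" and f :: "real ^ 'd \<Rightarrow> real"
    and \<sigma> p L \<theta> \<gamma> h :: real and T :: nat
    and w0 :: "real ^ 'd"
    and X :: "nat \<Rightarrow> 's \<Rightarrow> 'x"
    and w m :: "nat \<Rightarrow> 's \<Rightarrow> real ^ 'd"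
  assumes "prob_space D"
    and F_integrable: "\<And>w. integrable D (F w)"
    and f_eq: "f = objective D F"
    and F_differentiable: "\<And>\<xi> w. \<xi> \<in> space D \<Longrightarrow> (\<lambda>v. F v \<xi>) differentiable (at w)"
    and f_differentiable: "\<And>w. f differentiable (at w)"
    and f_bounded_below: "bdd_below (range f)"
    and "\<sigma> > 0" and "1 < p" and "p \<le> 2"
    and noise: "heavy_tailed_noise D F \<sigma> p"
    and "L > 0"
    and lipschitz: "individual_lipschitz D F L w0"
    and "T \<ge> 1"
    and "prob_space M"
    and samples_indep: "prob_space.indep_vars M (\<lambda>_. D) X {1..}"
    and samples_distr: "\<And>t. t \<ge> 1 \<Longrightarrow> distr M D (X t) = D"
    and algorithm: "\<And>s. s \<in> space M \<Longrightarrow>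
          nsgdc_vr F \<gamma> \<theta> h w0 (\<lambda>t. X t s) (\<lambda>t. w t s) (\<lambda>t. m t s)"
    and theta_eq: "1 - \<theta> = min (1 / (max (\<sigma> powr (p / (2*p - 1))) (\<sigma> powr ((2*p - 2) / (2*p - 1)))
                               * T powr (p / (2*p - 1)))) 1"
    and gamma_eq: "\<gamma> = root 4 (1 - \<theta>) / (L * sqrt T)"
    and h_eq: "h = 2 * (\<gamma> * L * T powr ((5*p + 2) / (8*p - 4)) * max 1 (\<sigma> powr (9*p / (8*p - 4)))
                        + norm (grad f w0))"
  shows "(1 / T) * (\<Sum>t = 1..T. \<integral>s. norm (grad f (w t s)) \<partial>M)
    \<le> (20 * \<sigma> powr (p / (2*p - 1))
          + 2 * norm (grad f w0) * (\<sigma> powr (p / (2*p - 1)) + \<sigma> powr ((2*p - 2) / (2*p - 1)))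
          + 16 * \<sigma> powr (p / 16)) / T powr ((p - 1) / (2*p - 1))
      + (L * (f w0 - (INF v. f v)) + 5)
          * (\<sigma> powr ((p - 1) / (4*p - 2)) + \<sigma> powr (p / (8*p - 4))) / T powr ((3*p - 2) / (8*p - 4))
      + 16 * rpow (norm (grad f w0)) ((2 - p) / 2)
          * (\<sigma> powr ((p^2 - p) / (2*p - 1)) + \<sigma> powr ((2*p^2 - 5*p + 2) / (4*p - 2)))
          / T powr (p / (4*p - 2))
      + 16 * \<sigma> powr ((5*p^2 - 9*p + 6) / (8*p - 4)) / T powr ((5*p - 1) / (8*p - 4))
      + (L * (f w0 - (INF v. f v)) + 16 * rpow (norm (grad f w0)) ((2 - p) / 2) + 9) / T powr (1 / 2)
      + 2 * norm (grad f w0) / T"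
proof -
  define G where "G = norm (grad f w0)"
  define f_min where "f_min = (INF v. f v)"
  define y where "y = root 4 (1 - \<theta>)"
  define H where "H = y / sqrt T * T powr ((5*p + 2) / (8*p - 4)) * max 1 (\<sigma> powr (9*p / (8*p - 4))) + G"
  have \<theta>: "0 \<le> \<theta>" "\<theta> < 1"
  proof -
    have "0 < 1 - \<theta>" "1 - \<theta> \<le> 1"
      unfolding theta_eq using \<open>\<sigma> > 0\<close> \<open>T \<ge> 1\<close> by (auto simp: less_max_iff_disj)
    then show "0 \<le> \<theta>" "\<theta> < 1" by auto
  qed
  have y: "y > 0" using \<theta> by (simp add: y_def)
  have L\<gamma>: "L * \<gamma> = y / sqrt T"
    using \<open>L > 0\<close> by (simp add: gamma_eq y_def)
  have \<gamma>: "\<gamma> > 0" using y \<open>L > 0\<close> \<open>T \<ge> 1\<close> by (simp add: gamma_eq y_def)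
  have h: "h / 2 = H"
    using L\<gamma> by (simp add: h_eq H_def G_def mult.commute)
  have H_ge: "G + L * \<gamma> * T \<le> H"
  proof -
    \<comment> \<open>The exponent is at least 1 exactly because \<open>p \<le> 2\<close>. So the
      prescribed threshold dominates the distance travelled in \<open>T\<close> steps.\<close>
    have "T \<le> T powr ((5*p + 2) / (8*p - 4))"
      using powr_mono[of 1 "(5*p + 2) / (8*p - 4)" "real T"] \<open>T \<ge> 1\<close> \<open>1 < p\<close> \<open>p \<le> 2\<close>
      by (simp add: field_simps)
    then have "real T * 1 \<le> T powr ((5*p + 2) / (8*p - 4)) * max 1 (\<sigma> powr (9*p / (8*p - 4)))"
      by (intro mult_mono) auto
    then show ?thesis
      unfolding L\<gamma> H_def mult.assoc using y by (simp add: mult_left_mono divide_right_mono)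
  qed
  have H_pos: "H > 0"
  proof -
    have "0 < L * \<gamma> * T" using \<open>L > 0\<close> \<gamma> \<open>T \<ge> 1\<close> by simp
    moreover have "0 \<le> G" by (simp add: G_def)
    ultimately show ?thesis using H_ge by linarith
  qed
  have noise_le: "(\<integral>\<^sup>+\<xi>. ennreal (norm (sgrad F v \<xi> - grad f v) powr p) \<partial>D) \<le> ennreal (\<sigma> powr p)" for v
    using noise unfolding heavy_tailed_noise_def f_eq by (rule order_trans[OF SUP_upper[OF UNIV_I]])
  have f_min: "f_min \<le> f v" for v
    unfolding f_min_def using f_bounded_below by (rule cINF_lower) simp
  interpret D: prob_space D by fact
  interpret M: prob_space M by fact
  interpret nsgdc_vr_run D "sgrad F" "grad f" L \<sigma> p M f X w m w0 \<gamma> \<theta> h f_min T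
  proof unfold_locales
    fix s t assume "s \<in> space M"
    note run = algorithm[OF this, unfolded nsgdc_vr_def]
    show "w 0 s = w0" "w 1 s = w0" "m 0 s = 0"
      using run by auto
    show "m (Suc t) s = \<theta> *\<^sub>R m t s
        + (1 - \<theta>) *\<^sub>R clip h (sgrad F (w (Suc t) s) (X (Suc t) s))
        + \<theta> *\<^sub>R sgrad F (w (Suc t) s) (X (Suc t) s) - \<theta> *\<^sub>R sgrad F (w t s) (X (Suc t) s)"
      "w (Suc (Suc t)) s = w (Suc t) s - \<gamma> *\<^sub>R sgn (m (Suc t) s)"
      using run[THEN conjunct2, THEN conjunct2, THEN conjunct2, rule_format, of "Suc t"] by auto
  next
    show "norm (sgrad F y \<xi> - sgrad F x \<xi>) \<le> L * norm (y - x)" if "\<xi> \<in> space D" for \<xi> x y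
      using lipschitz that unfolding individual_lipschitz_def by blast
    show "has_bochner_integral D (sgrad F v) (grad f v)" for v
      using lipschitz unfolding individual_lipschitz_def f_eq by blast
    show "norm (grad f w0) + L * \<gamma> * T \<le> h / 2"
      using H_ge h by (simp add: G_def)
    show "h > 0"
      using h H_pos by simp
    show "GDERIV f v :> grad f v" for v
      by (rule GDERIV_grad[OF f_differentiable])
  qed (fact noise_le f_min samples_indep samples_distr \<theta> \<gamma> assms | assumption)+
  have pos: "1 \<le> real T" "0 \<le> G" "0 \<le> L * (f w0 - f_min)"
    using \<open>T \<ge> 1\<close> \<open>L > 0\<close> f_min[of w0] by (simp_all add: G_def)
  have "(1 / T) * (\<Sum>t = 1..T. \<integral>s. norm (grad f (w t s)) \<partial>M)
    \<le> (f w0 - f_min) / (\<gamma> * T) + L * \<gamma> / 2 + 2 * G / (T * (1 - \<theta>))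
      + 2 * (\<sigma> powr p * (h / 2) powr (1 - p)) + 2 * sqrt (deviation_bound h \<theta> \<gamma> / (1 - \<theta>))"
    unfolding G_def by (rule average_gradient)
  also have "(f w0 - f_min) / (\<gamma> * T) = L * (f w0 - f_min) / (y * sqrt T)"
  proof -
    have "L * (\<gamma> * T) = y * (T / sqrt T)"
      using L\<gamma> by (simp flip: mult.assoc)
    then have "L * (\<gamma> * T) = y * sqrt T"
      by (simp add: real_div_sqrt)
    then show ?thesis
      using \<open>L > 0\<close> by (metis mult_divide_mult_cancel_left less_irrefl)
  qed
  also have "deviation_bound h \<theta> \<gamma>
      = 2 * (1 - \<theta>)\<^sup>2 * (\<sigma> powr p * (3 * H) powr (2 - p)) + 2 * (y / sqrt T)\<^sup>2"
    unfolding deviation_bound_def L\<gamma> using h by simp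
  also note h
  also note L\<gamma>
  also note rate_estimate[OF \<open>\<sigma> > 0\<close> \<open>1 < p\<close> \<open>p \<le> 2\<close> pos, folded theta_eq, folded y_def, folded H_def]
  finally show ?thesis
    by (simp only: G_def f_min_def)
qed

end
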